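(* Let $\Phi\in\Delta_2$ be an Orlicz function and let $E$ be a quasi-Banach symmetric sequence space. For every $n\in\mathbb{N}$ and for every sequence $(f_k)_{k=0}^{n-1}\subset L_{\Phi}(0,1)$ of independent random variables, with $f=\bigoplus_{k=0}^{n-1}f_k$, we have $$\int_0^1\Phi\Big(\Big\|\big(f_k(t)\big)_{k=0}^{n-1}\Big\|_E\Big)dt\approx_{E,\Phi}\int_0^1\Phi(\mu(t,f))\,dt+\Phi\Big(\Big\|\big(\mu(k,f)\big)_{k=1}^n\Big\|_E\Big),$$ where $\approx_{E,\Phi}$ means that the ratio of the two sides is bounded above and below by positive constants depending only on $E$ and $\Phi$ (not on $n$ or $(f_k)$).
   Context: Orlicz function: a continuous increasing convex $\Phi:[0,\infty)\to[0,\infty)$ with $\Phi(0)=0$ and $\lim_{t\to\infty}\Phi(t)=\infty$. $\Phi\in\Delta_2$ means there is $C>0$ with $\Phi(2t)\le C\Phi(t)$ for all $t>0$. $L_\Phi(0,1)$ is the class of measurable $f$ on $(0,1)$ with $\inf\{\lambda>0:\int_0^1\Phi(|f(t)|/\lambda)dt\le1\}<\infty$. Random variables are measurable functions on $(0,1)$ with Lebesgue measure $m$. For measurable $f$ on $(0,1)$ or $(0,\infty)$ put $d_{|f|}(s)=m(\{|f|>s\})$ and $\mu(t,f)=\inf\{\lambda\ge 0: d_{|f|}(\lambda)<t\}$, $t>0$ (decreasing rearrangement). For a bounded sequence $\xi=(\xi_n)_{n\ge0}$, $\mu(n,\xi)=\inf\{\lambda\ge0:\mathrm{Card}\{k\ge0:|\xi_k|>\lambda\}\le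 n\}$. A quasi-norm is positive definite, absolutely homogeneous, and satisfies $\|x+y\|\le C(\|x\|+\|y\|)$ for some constant $C$; quasi-Banach means complete. A quasi-Banach sequence space $E$ (of bounded sequences) is symmetric if $a\in E$, $\mu(b)\le\mu(a)$ imply $b\in E$, $\|b\|_E\le\|a\|_E$; the standard unit vectors $e_k$ lie in $E$ and $\|e_k\|_E=1$. Finite sequences are regarded as elements of $E$ by adding zeros. Disjoint sum: $\bigoplus_{k=0}^{n-1}f_k$ is the function on $(0,\infty)$ given by $\sum_k g_k$, where $g_k$ is a disjoint copy of $f_k$, e.g. $g_k(t)=f_k(t-k)\chi_{[k,k+1)}(t)$. *)

theory Defs
  imports "HOL-Probability.Probability"
begin

text \<open>Only the restriction of \<open>\<Phi>\<close> to \<open>{0..}\<close> is relevant.\<close>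

locale orlicz_function =
  fixes \<Phi> :: "real \<Rightarrow> real"
  assumes nonneg: "\<And>t. t \<ge> 0 \<Longrightarrow> \<Phi> t \<ge> 0"
    and continuous: "continuous_on {0..} \<Phi>"
    and increasing: "mono_on {0..} \<Phi>"
    and convex: "convex_on {0..} \<Phi>"
    and zero: "\<Phi> 0 = 0"
    and tendsto_top: "filterlim \<Phi> at_top at_top"

definition Delta2 :: "(real \<Rightarrow> real) \<Rightarrow> bool" where
  "Delta2 \<Phi> \<longleftrightarrow> (\<exists>C>0. \<forall>t>0. \<Phi> (2 * t) \<le> C * \<Phi> t)"

abbreviation unit_interval_measure :: "real measure" where
  "unit_interval_measure \<equiv> lebesgue_on {0<..<1}"

abbreviation half_line_measure :: "real measure" where
  "half_line_measure \<equiv> lebesgue_on {0<..}"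

lemma prob_space_unit_interval_measure: "prob_space unit_interval_measure"
  by (rule prob_spaceI) (simp add: emeasure_restrict_space)

text \<open>The infimum is taken in \<^typ>\<open>ennreal\<close>, so it is \<open>\<infinity>\<close> if no \<open>r\<close> is admissible.\<close>

definition orlicz_norm :: "(real \<Rightarrow> real) \<Rightarrow> (real \<Rightarrow> real) \<Rightarrow> ennreal" where
  "orlicz_norm \<Phi> f =
     Inf {ennreal r | r. r > 0 \<and>
            (\<integral>\<^sup>+t. ennreal (\<Phi> (\<bar>f t\<bar> / r)) \<partial>unit_interval_measure) \<le> 1}"

definition orlicz_space :: "(real \<Rightarrow> real) \<Rightarrow> (real \<Rightarrow> real) set" where
  "orlicz_space \<Phi> =
     {f \<in> borel_measurable unit_interval_measure. orlicz_norm \<Phi> f < \<infinity>}"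

definition distribution_fun :: "real measure \<Rightarrow> (real \<Rightarrow> real) \<Rightarrow> real \<Rightarrow> ennreal" where
  "distribution_fun M f s = emeasure M {x \<in> space M. \<bar>f x\<bar> > s}"

text \<open>
  The infimum is a real one, hence meaningful only if the set is nonempty. This is the case for
  all \<open>t > 0\<close> if \<open>f\<close> is measurable and vanishes outside a set of finite measure.
\<close>

definition rearrangement :: "real measure \<Rightarrow> (real \<Rightarrow> real) \<Rightarrow> real \<Rightarrow> real" where
  "rearrangement M f t = Inf {r. r \<ge> 0 \<and> distribution_fun M f r < ennreal t}"

text \<open>Finiteness is explicit because \<^const>\<open>card\<close> is \<open>0\<close> on infinite sets.\<close>

definition seq_rearrangement :: "(nat \<Rightarrow> real) \<Rightarrow> nat \<Rightarrow> real" where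
  "seq_rearrangement a n =
     Inf {r. r \<ge> 0 \<and> finite {k. \<bar>a k\<bar> > r} \<and> card {k. \<bar>a k\<bar> > r} \<le> n}"

definition unit_seq :: "nat \<Rightarrow> nat \<Rightarrow> real" where
  "unit_seq k = (\<lambda>j. if j = k then 1 else 0)"

definition finite_seq :: "nat \<Rightarrow> (nat \<Rightarrow> real) \<Rightarrow> nat \<Rightarrow> real" where
  "finite_seq n a = (\<lambda>k. if k < n then a k else 0)"

text \<open>A sequence space is a set \<open>E\<close> of bounded real sequences together with \<open>N\<close>, its quasi-norm;
  the values of \<open>N\<close> outside \<open>E\<close> are irrelevant.\<close>

locale quasi_normed_sequence_space =
  fixes E :: "(nat \<Rightarrow> real) set" and N :: "(nat \<Rightarrow> real) \<Rightarrow> real"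
  assumes bounded_seq: "\<And>a. a \<in> E \<Longrightarrow> Bseq a"
    and zero_mem: "(\<lambda>k. 0) \<in> E"
    and add_mem: "\<And>a b. a \<in> E \<Longrightarrow> b \<in> E \<Longrightarrow> (\<lambda>k. a k + b k) \<in> E"
    and scale_mem: "\<And>a c. a \<in> E \<Longrightarrow> (\<lambda>k. c * a k) \<in> E"
    and N_nonneg: "\<And>a. a \<in> E \<Longrightarrow> N a \<ge> 0"
    and N_eq_0_iff: "\<And>a. a \<in> E \<Longrightarrow> N a = 0 \<longleftrightarrow> a = (\<lambda>k. 0)"
    and N_scale: "\<And>a c. a \<in> E \<Longrightarrow> N (\<lambda>k. c * a k) = \<bar>c\<bar> * N a"
    and N_quasi_triangle:
      "\<exists>C. \<forall>a\<in>E. \<forall>b\<in>E. N (\<lambda>k. a k + b k) \<le> C * (N a + N b)"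

locale quasi_banach_sequence_space = quasi_normed_sequence_space +
  assumes complete:
    "\<And>X :: nat \<Rightarrow> nat \<Rightarrow> real.
       (\<And>i. X i \<in> E) \<Longrightarrow>
       (\<forall>e>0. \<exists>M. \<forall>i\<ge>M. \<forall>j\<ge>M. N (\<lambda>k. X i k - X j k) < e) \<Longrightarrow>
       \<exists>a\<in>E. (\<lambda>i. N (\<lambda>k. X i k - a k)) \<longlonglongrightarrow> 0"

locale symmetric_quasi_banach_sequence_space = quasi_banach_sequence_space +
  assumes symmetric:
    "\<And>a b. a \<in> E \<Longrightarrow> Bseq b \<Longrightarrow>
       (\<And>n. seq_rearrangement b n \<le> seq_rearrangement a n) \<Longrightarrow> b \<in> E \<and> N b \<le> N a"
    and unit_seq_mem: "\<And>k. unit_seq k \<in> E"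
    and N_unit_seq: "\<And>k. N (unit_seq k) = 1"

text \<open>The values at the integers, which involve \<open>f k 0\<close>, only concern a null set.\<close>

definition disjoint_sum :: "nat \<Rightarrow> (nat \<Rightarrow> real \<Rightarrow> real) \<Rightarrow> real \<Rightarrow> real" where
  "disjoint_sum n f =
     (\<lambda>t. \<Sum>k<n. f k (t - real k) * indicator {real k..<real k + 1} t)"

end

theory Submission
  imports Defs
begin

text \<open>
  Put \<open>d l = \<Sum>k<n. P(\<bar>f k\<bar> > l)\<close>. This is the distribution function of the disjoint sum, and
  \<open>\<mu>\<close> is its generalised inverse. So on average about \<open>j\<close> of the independent events
  \<open>\<bar>f k\<bar> > \<mu> j\<close> occur, and everything follows from the concentration of such counts:
  a sum \<open>S\<close> of independent indicators with mean \<open>p\<close> satisfies \<open>E (z ^ S) \<le> exp ((z - 1) * p)\<close>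
  for every \<open>z \<ge> 0\<close> (\<open>nn_integral_power_exceed\<close>).

  The space \<open>E\<close> enters only through \<open>N_dilation_bound\<close>: a sequence whose counting function is at
  most \<open>j\<close> times that of \<open>b\<close> has quasi-norm at most \<open>K ^ j * N b\<close>. By the doubling condition,
  \<open>\<Phi>\<close> then grows at most by a factor \<open>D ^ j\<close>. The crude exponential dependence on \<open>j\<close> suffices
  because every \<open>j\<close> that occurs is a count with exponential moments.

  Upper estimate: split every \<open>f k\<close> at the level \<open>\<mu> 1\<close>. The number of large values has mean at most
  one, and their sequence is dominated by that many copies of the largest of them; since \<open>f k\<close> is
  independent of the number of other large values, the expectation is at most a constant times
  \<open>\<Sum>k. E (\<Phi> \<bar>f k\<bar>)\<close> over the large values, which is at most the integral of \<open>\<Phi> \<circ> \<mu>\<close> over the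
  unit interval. For the small values let \<open>r\<close> be the least integer such that at most \<open>r j\<close> of the
  \<open>\<bar>f k\<bar>\<close> exceed \<open>\<mu> j\<close>, for all \<open>j \<le> n\<close> simultaneously. Their counting function is at most
  \<open>2 r\<close> times that of \<open>(\<mu> 1, \<dots>, \<mu> n)\<close>, and \<open>r\<close> has exponential moments of every order.

  Lower estimate: the quasi-norm dominates the largest coordinate, and the probability that the
  maximum of the \<open>\<bar>f k\<bar>\<close> exceeds \<open>l\<close> is at least half of \<open>min 1 (d l)\<close>; this controls the integral
  of \<open>\<Phi> \<circ> \<mu>\<close>. Moreover, by a Chernoff and a union bound there is an event of probability at least
  \<open>1 / 13\<close> on which at least \<open>j / 40\<close> of the \<open>\<bar>f k\<bar>\<close> exceed \<open>\<mu> j / 2\<close> for all \<open>j \<le> n\<close> with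
  \<open>\<mu> j > 0\<close>. On that event \<open>(\<mu> 1, \<dots>, \<mu> n)\<close> is dominated by a dilation of the sequence of the
  \<open>f k\<close>.

  In both directions the integrand \<open>\<Phi> (N (f 0 x, \<dots>, f (n - 1) x))\<close> is compared pointwise with a
  measurable function, so its measurability is never at issue.
\<close>

section \<open>Orlicz functions satisfying the doubling condition\<close>

context orlicz_function
begin

lemma mono: "0 \<le> x \<Longrightarrow> x \<le> y \<Longrightarrow> \<Phi> x \<le> \<Phi> y"
  using increasing by (auto simp: mono_on_def)

lemma dilation_power_bound:
  assumes "Delta2 \<Phi>" "K \<ge> 1"
  obtains D where "D \<ge> 2" "\<And>t m. t \<ge> 0 \<Longrightarrow> \<Phi> (K ^ m * t) \<le> D ^ m * \<Phi> t"
proof -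
  obtain C0 where C0: "\<And>t. t > 0 \<Longrightarrow> \<Phi> (2 * t) \<le> C0 * \<Phi> t"
    using assms(1) unfolding Delta2_def by blast
  define C where "C = max C0 1"
  have C: "\<Phi> (2 * t) \<le> C * \<Phi> t" if "t \<ge> 0" for t
  proof (cases "t = 0")
    case False
    have "\<Phi> (2 * t) \<le> C0 * \<Phi> t" using C0 False that by simp
    also have "\<dots> \<le> C * \<Phi> t"
      using nonneg[OF that] by (intro mult_right_mono) (auto simp: C_def)
    finally show ?thesis .
  qed (simp add: zero)
  have pow2: "\<Phi> (2 ^ j * t) \<le> C ^ j * \<Phi> t" if "t \<ge> 0" for j t
  proof (induction j)
    case (Suc j)
    have "\<Phi> (2 ^ Suc j * t) \<le> C * \<Phi> (2 ^ j * t)"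
      using C[of "2 ^ j * t"] that by (simp add: mult.assoc)
    also have "\<dots> \<le> C * (C ^ j * \<Phi> t)"
      using Suc by (intro mult_left_mono) (auto simp: C_def)
    finally show ?case by (simp add: mult.assoc)
  qed simp
  obtain j where j: "K \<le> 2 ^ j"
    using real_arch_pow[of 2 K] by (auto intro: less_imp_le)
  define D where "D = 2 * C ^ j"
  have "C ^ j \<ge> 1" by (simp add: C_def)
  hence D2: "D \<ge> 2" by (simp add: D_def)
  have D: "\<Phi> (K * t) \<le> D * \<Phi> t" if "t \<ge> 0" for t
  proof -
    have "\<Phi> (K * t) \<le> \<Phi> (2 ^ j * t)"
      using that j assms(2) by (intro mono mult_right_mono) auto
    also have "\<dots> \<le> C ^ j * \<Phi> t" by (rule pow2[OF that])
    also have "\<dots> \<le> D * \<Phi> t"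
      using \<open>C ^ j \<ge> 1\<close> nonneg[OF that] by (intro mult_right_mono) (auto simp: D_def)
    finally show ?thesis .
  qed
  have "\<Phi> (K ^ m * t) \<le> D ^ m * \<Phi> t" if "t \<ge> 0" for t m
  proof (induction m)
    case (Suc m)
    have "\<Phi> (K ^ Suc m * t) \<le> D * \<Phi> (K ^ m * t)"
      using D[of "K ^ m * t"] that assms(2) by (simp add: mult.assoc)
    also have "\<dots> \<le> D * (D ^ m * \<Phi> t)"
      using Suc D2 by (intro mult_left_mono) auto
    finally show ?case by (simp add: mult.assoc)
  qed simp
  with D2 that show ?thesis by blast
qed

text \<open>The doubling condition propagates a zero at a positive point to arbitrarily large
  arguments, which contradicts \<open>\<Phi> \<rightarrow> \<infinity>\<close>.\<close>

lemma pos: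
  assumes "Delta2 \<Phi>" "t > 0"
  shows "\<Phi> t > 0"
proof (rule ccontr)
  assume "\<not> \<Phi> t > 0"
  with nonneg[of t] assms(2) have t0: "\<Phi> t = 0" by simp
  obtain D where D: "\<And>t m. t \<ge> 0 \<Longrightarrow> \<Phi> (2 ^ m * t) \<le> D ^ m * \<Phi> t"
    by (rule dilation_power_bound[OF assms(1), of 2]) (simp, blast)
  have "eventually (\<lambda>x. \<Phi> x \<ge> 1) at_top"
    using tendsto_top by (simp add: filterlim_at_top)
  then obtain x0 where x0: "\<And>x. x \<ge> x0 \<Longrightarrow> \<Phi> x \<ge> 1"
    by (auto simp: eventually_at_top_linorder)
  obtain m where "x0 / t < 2 ^ m" using real_arch_pow[of 2 "x0 / t"] by auto
  hence "x0 \<le> 2 ^ m * t" using assms(2) by (simp add: field_simps)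
  from x0[OF this] D[of t m] t0 assms(2) show False by simp
qed

lemma strict_mono:
  assumes "Delta2 \<Phi>" "0 \<le> x" "x < y"
  shows "\<Phi> x < \<Phi> y"
proof -
  have y: "\<Phi> y > 0" using pos[OF assms(1)] assms by simp
  have "\<Phi> ((1 - x / y) * 0 + (x / y) * y) \<le> (1 - x / y) * \<Phi> 0 + (x / y) * \<Phi> y"
    using convex_onD[OF convex, of "x / y" 0 y] assms by simp
  hence "\<Phi> x \<le> (x / y) * \<Phi> y" using assms by (simp add: zero)
  also have "\<dots> < 1 * \<Phi> y" using y assms by (intro mult_strict_right_mono) auto
  finally show ?thesis by simp
qed

text \<open>Superlevel sets of \<open>\<Phi> \<circ> g\<close> are superlevel sets of \<open>g\<close>; this transfers comparisons of
  distribution functions to integrals of \<open>\<Phi>\<close>.\<close>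

lemma level_iff:
  assumes "Delta2 \<Phi>" "s \<ge> 0"
  obtains l where "l \<ge> 0" "\<And>x. x \<ge> 0 \<Longrightarrow> s < \<Phi> x \<longleftrightarrow> l < x"
proof -
  have "eventually (\<lambda>x. \<Phi> x \<ge> s) at_top"
    using tendsto_top by (simp add: filterlim_at_top)
  then obtain x0 where x0: "\<And>x. x \<ge> x0 \<Longrightarrow> \<Phi> x \<ge> s"
    by (auto simp: eventually_at_top_linorder)
  have "\<exists>l\<ge>0. l \<le> max x0 0 \<and> \<Phi> l = s"
    using x0[of "max x0 0"] assms(2) zero
    by (intro IVT') (auto intro: continuous_on_subset[OF continuous])
  then obtain l where l: "l \<ge> 0" "\<Phi> l = s" by blast
  have "s < \<Phi> x \<longleftrightarrow> l < x" if "x \<ge> 0" for x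
    using strict_mono[OF assms(1), of l x] mono[of x l] l that by fastforce
  with l that show ?thesis by blast
qed

lemma borel_measurable_abs [measurable]: "(\<lambda>x. \<Phi> \<bar>x\<bar>) \<in> borel_measurable borel"
  by (intro borel_measurable_continuous_onI continuous_on_compose2[OF continuous])
    (auto intro!: continuous_intros)

end

section \<open>Counting functions in symmetric sequence spaces\<close>

definition level_count :: "(nat \<Rightarrow> real) \<Rightarrow> real \<Rightarrow> nat" where
  "level_count a l = card {k. \<bar>a k\<bar> > l}"

lemma finite_seq_level:
  assumes "l \<ge> 0"
  shows "{k. \<bar>finite_seq n a k\<bar> > l} = {k. k < n \<and> \<bar>a k\<bar> > l}"
  using assms by (auto simp: finite_seq_def)

lemma level_count_finite_seq: "l \<ge> 0 \<Longrightarrow> level_count (finite_seq n a) l = card {k. k < n \<and> \<bar>a k\<bar> > l}"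
  by (simp add: level_count_def finite_seq_level)

lemma finite_level:
  assumes "finite {k. b k \<noteq> 0}" "l \<ge> 0"
  shows "finite {k. \<bar>b k :: real\<bar> > l}"
  by (rule finite_subset[OF _ assms(1)]) (use assms(2) in auto)

lemma Bseq_finite_support:
  assumes "finite {k. b k \<noteq> (0::real)}"
  shows "Bseq b"
proof (rule BseqI')
  fix k
  show "norm (b k) \<le> (\<Sum>j\<in>{k. b k \<noteq> 0}. \<bar>b j\<bar>)"
  proof (cases "b k = 0")
    case False
    then show ?thesis using assms by (auto intro: member_le_sum)
  qed (simp add: sum_nonneg)
qed

lemma seq_rearrangement_mono:
  assumes fin: "finite {k. a k \<noteq> 0}" "finite {k. b k \<noteq> 0}"
    and le: "\<And>l. l \<ge> 0 \<Longrightarrow> level_count b l \<le> level_count a l"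
  shows "seq_rearrangement b n \<le> seq_rearrangement a n"
  unfolding seq_rearrangement_def
proof (rule cInf_superset_mono)
  obtain B where B: "\<And>k. \<bar>a k\<bar> \<le> B"
    using Bseq_finite_support[OF fin(1)] by (auto simp: Bseq_def)
  have "\<bar>a 0\<bar> \<le> B" by (rule B)
  hence "B \<ge> 0" by linarith
  moreover have "{k. \<bar>a k\<bar> > B} = {}" using B by (auto simp: not_less)
  ultimately show "{r. 0 \<le> r \<and> finite {k. r < \<bar>a k\<bar>} \<and> card {k. r < \<bar>a k\<bar>} \<le> n} \<noteq> {}"
    by (intro ex_in_conv[THEN iffD1] exI[of _ B]) simp
  show "bdd_below {r. 0 \<le> r \<and> finite {k. r < \<bar>b k\<bar>} \<and> card {k. r < \<bar>b k\<bar>} \<le> n}"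
    by (rule bdd_belowI[of _ 0]) auto
  show "{r. 0 \<le> r \<and> finite {k. r < \<bar>a k\<bar>} \<and> card {k. r < \<bar>a k\<bar>} \<le> n}
      \<subseteq> {r. 0 \<le> r \<and> finite {k. r < \<bar>b k\<bar>} \<and> card {k. r < \<bar>b k\<bar>} \<le> n}"
    using le finite_level[OF fin(2)] by (auto simp: level_count_def intro: order_trans)
qed

context symmetric_quasi_banach_sequence_space
begin

lemma N_zero: "N (\<lambda>k. 0) = 0"
  using N_eq_0_iff[OF zero_mem] by simp

lemma sum_mem:
  assumes "finite I" "\<And>i. i \<in> I \<Longrightarrow> p i \<in> E"
  shows "(\<lambda>k. \<Sum>i\<in>I. p i k) \<in> E"
  using assms by (induction I rule: finite_induct) (auto simp: zero_mem intro: add_mem)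

lemma finite_support_mem:
  assumes "finite {k. b k \<noteq> 0}"
  shows "b \<in> E"
proof -
  have "(\<lambda>k. \<Sum>j\<in>{k. b k \<noteq> 0}. b j * unit_seq j k) \<in> E"
    by (intro sum_mem assms scale_mem unit_seq_mem)
  also have "(\<lambda>k. \<Sum>j\<in>{k. b k \<noteq> 0}. b j * unit_seq j k) = b"
    using assms by (auto simp: unit_seq_def if_distrib[of "\<lambda>x. _ * x"] sum.delta cong: if_cong)
  finally show ?thesis .
qed

lemma finite_seq_support: "finite {k. finite_seq n a k \<noteq> 0}"
  by (rule finite_subset[of _ "{..<n}"]) (auto simp: finite_seq_def)

lemma finite_seq_mem: "finite_seq n a \<in> E"
  by (intro finite_support_mem finite_seq_support)

text \<open>Symmetry in terms of counting functions, which are easier to estimate than rearrangements.\<close>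

lemma N_mono:
  assumes "finite {k. a k \<noteq> 0}" "finite {k. b k \<noteq> 0}"
    and "\<And>l. l \<ge> 0 \<Longrightarrow> level_count b l \<le> level_count a l"
  shows "N b \<le> N a"
  using symmetric[OF finite_support_mem[OF assms(1)] Bseq_finite_support[OF assms(2)]
      seq_rearrangement_mono[OF assms]] by blast

text \<open>If the counting function of \<open>y\<close> is at most \<open>m\<close> times that of \<open>b\<close>, then \<open>y\<close> is dominated
  by the sequence that repeats each entry of \<open>b\<close> exactly \<open>m\<close> times. This is a sum of \<open>m\<close>
  rearrangements of \<open>b\<close>, so iterating the quasi-triangle inequality costs a factor exponential in
  \<open>m\<close>. The exponential growth is harmless because the random \<open>m\<close> to which this is applied have
  exponential moments of every order.\<close>

lemma N_dilation_bound:
  obtains K where "K \<ge> 2"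
    "\<And>a b. a \<in> E \<Longrightarrow> b \<in> E \<Longrightarrow> N (\<lambda>k. a k + b k) \<le> K * max (N a) (N b)"
    "\<And>y b m. finite {k. y k \<noteq> 0} \<Longrightarrow> finite {k. b k \<noteq> 0} \<Longrightarrow>
      (\<And>l. l \<ge> 0 \<Longrightarrow> level_count y l \<le> m * level_count b l) \<Longrightarrow> N y \<le> K ^ m * N b"
proof -
  obtain C0 where C0: "\<forall>a\<in>E. \<forall>b\<in>E. N (\<lambda>k. a k + b k) \<le> C0 * (N a + N b)"
    using N_quasi_triangle by blast
  define C where "C = max C0 1"
  have C: "N (\<lambda>k. a k + b k) \<le> C * (N a + N b)" if "a \<in> E" "b \<in> E" for a b
  proof -
    have "N (\<lambda>k. a k + b k) \<le> C0 * (N a + N b)" using C0 that by blast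
    also have "\<dots> \<le> C * (N a + N b)"
      using N_nonneg that by (intro mult_right_mono) (auto simp: C_def)
    finally show ?thesis .
  qed
  have sum_bound: "N (\<lambda>k. \<Sum>i<m. p i k) \<le> (2 * C) ^ m * B"
    if p: "\<And>i. i < m \<Longrightarrow> p i \<in> E" "\<And>i. i < m \<Longrightarrow> N (p i) \<le> B" and B: "B \<ge> 0"
    for p :: "nat \<Rightarrow> nat \<Rightarrow> real" and m B
    using p
  proof (induction m)
    case (Suc m)
    have "N (\<lambda>k. \<Sum>i<Suc m. p i k) \<le> C * (N (\<lambda>k. \<Sum>i<m. p i k) + N (p m))"
      using C[OF sum_mem[of "{..<m}" p], of "p m"] Suc.prems by simp
    also have "\<dots> \<le> C * ((2 * C) ^ m * B + (2 * C) ^ m * B)"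
    proof (intro mult_left_mono add_mono)
      show "N (\<lambda>k. \<Sum>i<m. p i k) \<le> (2 * C) ^ m * B" using Suc by simp
      have "N (p m) \<le> 1 * B" using Suc.prems by simp
      also have "\<dots> \<le> (2 * C) ^ m * B"
        using B by (intro mult_right_mono one_le_power) (auto simp: C_def)
      finally show "N (p m) \<le> (2 * C) ^ m * B" .
    qed (simp add: C_def)
    finally show ?case by (simp add: algebra_simps)
  qed (use B in \<open>simp add: N_zero\<close>)
  have main: "N y \<le> (2 * C) ^ m * N b"
    if fin: "finite {k. y k \<noteq> 0}" "finite {k. b k \<noteq> 0}"
      and le: "\<And>l. l \<ge> 0 \<Longrightarrow> level_count y l \<le> m * level_count b l" for y b m
  proof (cases "m = 0")
    case True
    with le[of 0] fin(1) have "y = (\<lambda>k. 0)" by (auto simp: level_count_def)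
    then show ?thesis using N_nonneg[OF finite_support_mem[OF fin(2)]] True by (simp add: N_zero)
  next
    case False
    hence m: "m > 0" by simp
    (* p i keeps the i-th copy of every entry of the dilated sequence z *)
    define p where "p i k = (if k mod m = i then b (k div m) else 0)" for i k
    define z where "z k = b (k div m)" for k
    have z_supp: "{k. P (b (k div m))} = (\<lambda>(j, i). m * j + i) ` ({j. P (b j)} \<times> {..<m})"
      for P :: "real \<Rightarrow> bool"
    proof (intro equalityI subsetI)
      fix k assume "k \<in> {k. P (b (k div m))}"
      thus "k \<in> (\<lambda>(j, i). m * j + i) ` ({j. P (b j)} \<times> {..<m})"
        using m by (intro image_eqI[of _ _ "(k div m, k mod m)"]) auto
    qed (use m in auto)
    have inj: "inj_on (\<lambda>(j, i). m * j + i) (A \<times> {..<m})" for A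
      by (rule inj_onI) (auto, (metis m add.commute div_mult_self_is_m lessThan_iff mod_less
        mod_mult_self4 mult.commute add_right_cancel nat_mult_eq_cancel1)+)
    have z_fin: "finite {k. z k \<noteq> 0}"
      unfolding z_def z_supp[of "\<lambda>x. x \<noteq> 0"] using fin by auto
    have z_count: "level_count z l = m * level_count b l" for l
      unfolding z_def level_count_def z_supp[of "\<lambda>x. l < \<bar>x\<bar>"]
      by (simp add: card_image[OF inj] card_cartesian_product)
    have p_le: "N (p i) \<le> N b" and p_mem: "p i \<in> E" if "i < m" for i
    proof -
      have p_fin: "finite {k. p i k \<noteq> 0}"
        by (rule finite_subset[OF _ z_fin]) (auto simp: p_def z_def split: if_splits)
      thus "p i \<in> E" by (rule finite_support_mem)
      show "N (p i) \<le> N b"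
      proof (rule N_mono[OF fin(2) p_fin])
        fix l :: real assume l: "l \<ge> 0"
        have "{k. \<bar>p i k\<bar> > l} \<subseteq> (\<lambda>j. m * j + i) ` {j. \<bar>b j\<bar> > l}"
        proof
          fix k assume "k \<in> {k. \<bar>p i k\<bar> > l}"
          hence "k mod m = i" "\<bar>b (k div m)\<bar> > l"
            using l by (auto simp: p_def split: if_splits)
          thus "k \<in> (\<lambda>j. m * j + i) ` {j. \<bar>b j\<bar> > l}"
            by (intro image_eqI[of _ _ "k div m"]) auto
        qed
        thus "level_count (p i) l \<le> level_count b l"
          unfolding level_count_def using finite_level[OF fin(2) l] by (rule surj_card_le[rotated])
      qed
    qed
    have "N y \<le> N z"
      by (rule N_mono[OF z_fin fin(1)]) (simp add: z_count le)
    also have "z = (\<lambda>k. \<Sum>i<m. p i k)"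
      using m by (auto simp: z_def p_def)
    also have "N (\<lambda>k. \<Sum>i<m. p i k) \<le> (2 * C) ^ m * N b"
      using p_le p_mem N_nonneg[OF finite_support_mem[OF fin(2)]] by (intro sum_bound) auto
    finally show ?thesis .
  qed
  show ?thesis
  proof (rule that[OF _ _ main])
    show "2 * C \<ge> 2" by (simp add: C_def)
    fix a b assume ab: "a \<in> E" "b \<in> E"
    have "C * (N a + N b) \<le> C * (2 * max (N a) (N b))"
      by (intro mult_left_mono) (auto simp: C_def)
    with C[OF ab] show "N (\<lambda>k. a k + b k) \<le> 2 * C * max (N a) (N b)" by simp
  qed
qed

lemma abs_le_N:
  assumes "k < n"
  shows "\<bar>a k\<bar> \<le> N (finite_seq n a)"
proof -
  have fin: "finite {j. a k * unit_seq k j \<noteq> 0}"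
    by (rule finite_subset[of _ "{k}"]) (auto simp: unit_seq_def)
  have "N (\<lambda>j. a k * unit_seq k j) \<le> N (finite_seq n a)"
  proof (rule N_mono[OF finite_seq_support fin])
    fix l :: real assume l: "l \<ge> 0"
    have "{j. \<bar>a k * unit_seq k j\<bar> > l} \<subseteq> {j. \<bar>finite_seq n a j\<bar> > l}"
      using l assms by (auto simp: unit_seq_def finite_seq_def)
    thus "level_count (\<lambda>j. a k * unit_seq k j) l \<le> level_count (finite_seq n a) l"
      unfolding level_count_def by (intro card_mono finite_level finite_seq_support l)
  qed
  thus ?thesis using N_scale[OF unit_seq_mem, of "a k" k] N_unit_seq by simp
qed

end

section \<open>Distribution and rearrangement of a disjoint sum\<close>

context prob_space
begin

definition tail_sum :: "nat \<Rightarrow> (nat \<Rightarrow> 'a \<Rightarrow> real) \<Rightarrow> real \<Rightarrow> real" where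
  "tail_sum n f l = (\<Sum>k<n. prob {x \<in> space M. \<bar>f k x\<bar> > l})"

lemma tail_sum_nonneg: "tail_sum n f l \<ge> 0"
  by (auto simp: tail_sum_def intro: sum_nonneg)

lemma tail_sum_antimono:
  assumes [measurable]: "\<And>k. k < n \<Longrightarrow> random_variable borel (f k)" and "l \<le> l'"
  shows "tail_sum n f l' \<le> tail_sum n f l"
  unfolding tail_sum_def using assms(2) by (intro sum_mono finite_measure_mono) auto

lemma tail_sum_right_continuous:
  assumes [measurable]: "\<And>k. k < n \<Longrightarrow> random_variable borel (f k)"
  shows "(\<lambda>i. tail_sum n f (l + inverse (real (Suc i)))) \<longlonglongrightarrow> tail_sum n f l"
  unfolding tail_sum_def
proof (rule tendsto_sum)
  fix k assume k: "k \<in> {..<n}"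
  define A where "A i = {x \<in> space M. \<bar>f k x\<bar> > l + inverse (real (Suc i))}" for i
  have "(\<lambda>i. prob (A i)) \<longlonglongrightarrow> prob (\<Union>i. A i)"
  proof (rule finite_Lim_measure_incseq)
    show "range A \<subseteq> events" using k by (auto simp: A_def)
    have "inverse (real (Suc j)) \<le> inverse (real (Suc i))" if "i \<le> j" for i j
      using that by (intro le_imp_inverse_le) auto
    thus "incseq A"
      unfolding incseq_def A_def by (blast intro: le_less_trans add_left_mono)
  qed
  also have "(\<Union>i. A i) = {x \<in> space M. \<bar>f k x\<bar> > l}"
  proof (intro equalityI subsetI)
    fix x assume "x \<in> {x \<in> space M. \<bar>f k x\<bar> > l}"
    thus "x \<in> (\<Union>i. A i)"
      using reals_Archimedean[of "\<bar>f k x\<bar> - l"] by (auto simp: A_def algebra_simps)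
  next
    fix x assume "x \<in> (\<Union>i. A i)"
    then obtain i where x: "x \<in> space M" and "\<bar>f k x\<bar> > l + inverse (real (Suc i))"
      by (auto simp: A_def)
    moreover have "inverse (real (Suc i)) > 0" by simp
    ultimately have "\<bar>f k x\<bar> > l" by linarith
    with x show "x \<in> {x \<in> space M. \<bar>f k x\<bar> > l}" by simp
  qed
  finally show "(\<lambda>i. prob {x \<in> space M. \<bar>f k x\<bar> > l + inverse (real (Suc i))})
      \<longlonglongrightarrow> prob {x \<in> space M. \<bar>f k x\<bar> > l}"
    by (simp add: A_def)
qed

lemma tail_sum_tendsto_0:
  assumes [measurable]: "\<And>k. k < n \<Longrightarrow> random_variable borel (f k)"
  shows "(\<lambda>i. tail_sum n f (real i)) \<longlonglongrightarrow> 0"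
proof -
  have "(\<lambda>i. prob {x \<in> space M. \<bar>f k x\<bar> > real i}) \<longlonglongrightarrow> 0" if k: "k < n" for k
  proof -
    have "(\<lambda>i. prob {x \<in> space M. \<bar>f k x\<bar> > real i})
        \<longlonglongrightarrow> prob (\<Inter>i. {x \<in> space M. \<bar>f k x\<bar> > real i})"
      by (rule finite_Lim_measure_decseq) (use k in \<open>auto simp: decseq_def\<close>)
    also have "(\<Inter>i. {x \<in> space M. \<bar>f k x\<bar> > real i}) = {}"
    proof -
      have "\<exists>i. \<not> \<bar>f k x\<bar> > real i" for x
        using real_arch_simple[of "\<bar>f k x\<bar>"] by (auto simp: not_less)
      thus ?thesis by blast
    qed
    finally show ?thesis by simp
  qed
  hence "(\<lambda>i. \<Sum>k<n. prob {x \<in> space M. \<bar>f k x\<bar> > real i}) \<longlonglongrightarrow> (\<Sum>k<n. 0)"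
    by (intro tendsto_sum) auto
  thus ?thesis by (simp add: tail_sum_def)
qed

end

text \<open>The rearrangement depends on the disjoint sum only through \<open>tail_sum n f\<close>, so the probabilistic
  argument takes place on an arbitrary probability space, with \<open>\<mu>\<close> as the generalised inverse of
  \<open>tail_sum n f\<close>.\<close>

locale rearranged_tail = prob_space M for M :: "'a measure" +
  fixes n :: nat and f :: "nat \<Rightarrow> 'a \<Rightarrow> real" and \<mu> :: "real \<Rightarrow> real"
  assumes rv [measurable]: "\<And>k. k < n \<Longrightarrow> random_variable borel (f k)"
    and \<mu>_eq: "\<And>t. t > 0 \<Longrightarrow> \<mu> t = Inf {r. r \<ge> 0 \<and> tail_sum n f r < t}"
begin

abbreviation d :: "real \<Rightarrow> real" where
  "d \<equiv> tail_sum n f"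

lemma d_antimono: "l \<le> l' \<Longrightarrow> d l' \<le> d l"
  by (intro tail_sum_antimono rv)

lemma admissible_level_exists:
  assumes "t > 0"
  shows "\<exists>r. r \<ge> 0 \<and> d r < t"
proof -
  have "eventually (\<lambda>i. d (real i) < t) sequentially"
    using order_tendstoD(2)[OF tail_sum_tendsto_0[where f = f and n = n, OF rv] assms] by simp
  then obtain i where "d (real i) < t" by (auto simp: eventually_sequentially)
  thus ?thesis by (intro exI[of _ "real i"]) auto
qed

lemma \<mu>_nonneg: "t > 0 \<Longrightarrow> \<mu> t \<ge> 0"
  using admissible_level_exists by (subst \<mu>_eq) (auto intro!: cInf_greatest)

lemma \<mu>_le: "t > 0 \<Longrightarrow> r \<ge> 0 \<Longrightarrow> d r < t \<Longrightarrow> \<mu> t \<le> r"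
  by (subst \<mu>_eq) (auto intro!: cInf_lower bdd_belowI[of _ 0])

lemma le_d: "t > 0 \<Longrightarrow> l \<ge> 0 \<Longrightarrow> l < \<mu> t \<Longrightarrow> t \<le> d l"
  using \<mu>_le[of t l] by (meson not_le)

text \<open>The infimum defining \<open>\<mu> t\<close> need not be attained, but right continuity of \<open>d\<close> still gives
  the weak inequality there.\<close>

lemma d_\<mu>_le:
  assumes t: "t > 0"
  shows "d (\<mu> t) \<le> t"
proof (rule LIMSEQ_le_const2[OF tail_sum_right_continuous[where f = f and n = n, OF rv]])
  show "\<exists>N. \<forall>i\<ge>N. d (\<mu> t + inverse (real (Suc i))) \<le> t"
  proof (intro exI allI impI)
    fix i :: nat
    have "Inf {r. r \<ge> 0 \<and> d r < t} < \<mu> t + inverse (real (Suc i))"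
      using t by (simp add: \<mu>_eq)
    then obtain r where "r \<ge> 0" "d r < t" "r < \<mu> t + inverse (real (Suc i))"
      using admissible_level_exists[OF t] by (subst (asm) cInf_less_iff) (auto intro!: bdd_belowI[of _ 0])
    with d_antimono[of r "\<mu> t + inverse (real (Suc i))"]
    show "d (\<mu> t + inverse (real (Suc i))) \<le> t" by simp
  qed
qed

lemma \<mu>_antimono:
  assumes "0 < s" "s \<le> t"
  shows "\<mu> t \<le> \<mu> s"
  unfolding \<mu>_eq[OF assms(1)] \<mu>_eq[OF less_le_trans[OF assms]]
  using admissible_level_exists[OF assms(1)] assms(2)
  by (intro cInf_superset_mono) (auto intro!: bdd_belowI[of _ 0])

lemma borel_measurable_\<mu>: "\<mu> \<in> borel_measurable unit_interval_measure"
proof -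
  have "{x \<in> space unit_interval_measure. \<mu> x > c} \<in> sets unit_interval_measure" for c
  proof -
    have "is_interval {x \<in> {0<..<1}. \<mu> x > c}"
      unfolding is_interval_1 using \<mu>_antimono by (fastforce intro: less_le_trans)
    hence "{x \<in> {0<..<1}. \<mu> x > c} \<in> sets lebesgue"
      by (intro sets_completionI_sets) (simp add: real_interval_borel_measurable)
    thus ?thesis by (auto simp: sets_restrict_space_iff space_restrict_space)
  qed
  thus ?thesis by (simp add: borel_measurable_iff_greater)
qed

text \<open>On the unit interval \<open>\<mu>\<close> has the distribution function \<open>min 1 \<circ> d\<close>, because \<open>l < \<mu> t\<close>
  forces \<open>t \<le> d l\<close> and is forced by \<open>t < d l\<close>. The two inequalities are stated separately.\<close>

lemma emeasure_\<mu>_gt_le: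
  assumes l: "l \<ge> 0"
  shows "emeasure unit_interval_measure {t \<in> space unit_interval_measure. \<mu> t > l}
    \<le> ennreal (min 1 (d l))"
proof -
  define b where "b = min 1 (d l)"
  have b: "b \<ge> 0" using tail_sum_nonneg by (simp add: b_def)
  have sub: "{t \<in> space unit_interval_measure. \<mu> t > l} \<subseteq> {0..b}"
    using le_d l by (auto simp: space_restrict_space b_def)
  have "emeasure unit_interval_measure {t \<in> space unit_interval_measure. \<mu> t > l}
      = emeasure lebesgue {t \<in> space unit_interval_measure. \<mu> t > l}"
    by (rule emeasure_restrict_space) (auto simp: space_restrict_space)
  also have "\<dots> \<le> emeasure lebesgue {0..b}"
    by (intro emeasure_mono sub) auto
  also have "\<dots> = ennreal b" using b by simp
  finally show ?thesis by (simp add: b_def)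
qed

lemma emeasure_\<mu>_gt_ge:
  assumes l: "l \<ge> 0"
  shows "ennreal (min 1 (d l))
    \<le> emeasure unit_interval_measure {t \<in> space unit_interval_measure. \<mu> t > l}"
proof -
  define b where "b = min 1 (d l)"
  have b: "b \<ge> 0" using tail_sum_nonneg by (simp add: b_def)
  have "\<mu> t > l" if t: "0 < t" "t < b" for t
  proof (rule ccontr)
    assume "\<not> \<mu> t > l"
    hence "d l \<le> d (\<mu> t)" by (intro d_antimono) auto
    with d_\<mu>_le[OF t(1)] t show False by (simp add: b_def)
  qed
  hence sub: "{0<..<b} \<subseteq> {t \<in> space unit_interval_measure. \<mu> t > l}"
    by (auto simp: space_restrict_space b_def)
  have "ennreal b = emeasure lebesgue {0<..<b}" using b by simp
  also have "\<dots> = emeasure unit_interval_measure {0<..<b}"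
    by (rule emeasure_restrict_space[symmetric]) (auto simp: b_def)
  also have "\<dots> \<le> emeasure unit_interval_measure {t \<in> space unit_interval_measure. \<mu> t > l}"
    by (intro emeasure_mono sub) (use borel_measurable_\<mu> in measurable)
  finally show ?thesis by (simp add: b_def)
qed

end

lemma disjoint_sum_eq:
  assumes "real m \<le> x" "x < real m + 1"
  shows "disjoint_sum n f x = (if m < n then f m (x - real m) else 0)"
proof -
  have "x \<in> {real k..<real k + 1} \<longleftrightarrow> k = m" for k
    using assms by auto
  thus ?thesis
    unfolding disjoint_sum_def by (simp add: indicator_def if_distrib[of "\<lambda>x. _ * x"] cong: if_cong)
qed

text \<open>Off the integers, the superlevel set of the disjoint sum is the disjoint union of translated
  superlevel sets of the \<open>f k\<close>.\<close>

lemma distribution_disjoint_sum: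
  assumes f: "\<And>k. k < n \<Longrightarrow> f k \<in> borel_measurable unit_interval_measure" and r: "r \<ge> 0"
  shows "distribution_fun half_line_measure (disjoint_sum n f) r
    = ennreal (prob_space.tail_sum unit_interval_measure n f r)"
proof -
  interpret U: prob_space unit_interval_measure by (rule prob_space_unit_interval_measure)
  define A where "A k = {x \<in> space unit_interval_measure. \<bar>f k x\<bar> > r}" for k
  define B where "B = {x \<in> space half_line_measure. \<bar>disjoint_sum n f x\<bar> > r}"
  define T where "T = (\<Union>k<n. (\<lambda>x. real k + x) ` A k)"
  define Z where "Z = range real"
  have A_unit: "A k \<in> sets unit_interval_measure" if "k < n" for k
    unfolding A_def using f[OF that] by measurable
  hence A_leb: "A k \<in> sets lebesgue" if "k < n" for k
    using that by (auto simp: sets_restrict_space_iff)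
  have A_sub: "A k \<subseteq> {0<..<1}" for k by (auto simp: A_def space_restrict_space)
  have T_leb: "(\<lambda>x. real k + x) ` A k \<in> sets lebesgue" if "k < n" for k
    by (intro lebesgue_sets_translation A_leb that)
  have "Z \<in> null_sets lborel"
    unfolding Z_def by (intro countable_imp_null_set_lborel) auto
  hence Z: "Z \<in> null_sets lebesgue" by (rule null_sets_completionI)
  have BT: "B - Z = T - Z"
  proof (intro set_eqI iffI)
    fix x assume x: "x \<in> B - Z"
    define m where "m = nat \<lfloor>x\<rfloor>"
    have x0: "x > 0" "x \<noteq> real m" using x by (auto simp: B_def Z_def space_restrict_space)
    have m: "real m \<le> x" "x < real m + 1" using x0 unfolding m_def by linarith+
    have "m < n" "\<bar>f m (x - real m)\<bar> > r"
      using x r by (auto simp: B_def disjoint_sum_eq[OF m] split: if_splits)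
    thus "x \<in> T - Z" using x m x0
      by (auto simp: T_def A_def space_restrict_space intro!: bexI[of _ m] image_eqI[of _ _ "x - real m"])
  next
    fix x assume x: "x \<in> T - Z"
    then obtain m y where m: "m < n" "y \<in> A m" "x = real m + y" by (auto simp: T_def)
    hence y: "0 < y" "y < 1" using A_sub[of m] by auto
    have "disjoint_sum n f x = f m y"
      using m y by (subst disjoint_sum_eq[of m]) auto
    thus "x \<in> B - Z" using m y x by (auto simp: B_def A_def space_restrict_space)
  qed
  have B_eq: "B = (T - Z) \<union> (B \<inter> Z)" using BT by blast
  have Z_sub: "B \<inter> Z \<in> null_sets lebesgue"
    using Z by (rule null_sets_completion_subset[rotated]) auto
  have T_sets: "T \<in> sets lebesgue" using T_leb by (auto simp: T_def)
  have "distribution_fun half_line_measure (disjoint_sum n f) r = emeasure half_line_measure B"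
    by (simp add: distribution_fun_def B_def)
  also have "\<dots> = emeasure lebesgue B"
    by (intro emeasure_restrict_space) (auto simp: B_def space_restrict_space)
  also have "\<dots> = emeasure lebesgue ((T - Z) \<union> (B \<inter> Z))" using B_eq by simp
  also have "\<dots> = emeasure lebesgue (T - Z)"
    using T_sets Z Z_sub by (intro emeasure_Un_null_set) auto
  also have "\<dots> = emeasure lebesgue T"
    using T_sets Z by (intro emeasure_Diff_null_set)
  also have "\<dots> = (\<Sum>k<n. emeasure lebesgue ((\<lambda>x. real k + x) ` A k))"
    unfolding T_def
  proof (rule sum_emeasure[symmetric])
    show "disjoint_family_on (\<lambda>k. (\<lambda>x. real k + x) ` A k) {..<n}"
      unfolding disjoint_family_on_def
    proof (intro ballI impI, rule ccontr)
      fix i j assume ij: "i \<noteq> j" "(\<lambda>x. real i + x) ` A i \<inter> (\<lambda>x. real j + x) ` A j \<noteq> {}"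
      then obtain x y where "x \<in> A i" "y \<in> A j" "real i + x = real j + y" by auto
      hence "\<bar>real i - real j\<bar> < 1" using A_sub[of i] A_sub[of j] by fastforce
      with ij(1) show False by linarith
    qed
  qed (use T_leb in auto)
  also have "\<dots> = (\<Sum>k<n. emeasure unit_interval_measure (A k))"
  proof (rule sum.cong)
    fix k assume "k \<in> {..<n}"
    have "emeasure lebesgue ((\<lambda>x. real k + x) ` A k) = emeasure lebesgue (A k)"
      using emeasure_lebesgue_affine[of 1 "real k" "A k"] by (simp add: add.commute)
    also have "\<dots> = emeasure unit_interval_measure (A k)"
      using A_sub by (intro emeasure_restrict_space[symmetric]) auto
    finally show "emeasure lebesgue ((\<lambda>x. real k + x) ` A k) = emeasure unit_interval_measure (A k)" .
  qed simp
  also have "\<dots> = ennreal (U.tail_sum n f r)"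
    by (simp add: U.tail_sum_def A_def U.emeasure_eq_measure sum_ennreal)
  finally show ?thesis .
qed

lemma rearrangement_disjoint_sum:
  assumes f: "\<And>k. k < n \<Longrightarrow> f k \<in> borel_measurable unit_interval_measure"
  shows "rearranged_tail unit_interval_measure n f
    (rearrangement half_line_measure (disjoint_sum n f))"
proof -
  interpret U: prob_space unit_interval_measure by (rule prob_space_unit_interval_measure)
  show ?thesis
  proof
    fix t :: real assume t: "t > 0"
    have "{r. r \<ge> 0 \<and> distribution_fun half_line_measure (disjoint_sum n f) r < ennreal t}
        = {r. r \<ge> 0 \<and> U.tail_sum n f r < t}"
      using distribution_disjoint_sum[OF f] t by (auto simp: ennreal_less_iff U.tail_sum_nonneg)
    thus "rearrangement half_line_measure (disjoint_sum n f) t = Inf {r. r \<ge> 0 \<and> U.tail_sum n f r < t}"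
      by (simp add: rearrangement_def)
  qed (rule f)
qed

section \<open>Exponential moments of counting variables\<close>

context prob_space
begin

definition exceed :: "nat \<Rightarrow> (nat \<Rightarrow> 'a \<Rightarrow> real) \<Rightarrow> real \<Rightarrow> 'a \<Rightarrow> nat" where
  "exceed n f l x = card {k. k < n \<and> \<bar>f k x\<bar> > l}"

lemma power_exceed:
  "z ^ exceed n f l x = (\<Prod>k<n. if \<bar>f k x\<bar> > l then z else (1::'b::comm_monoid_mult))"
proof -
  have "(\<Prod>k<n. if \<bar>f k x\<bar> > l then z else 1) = (\<Prod>k\<in>{k\<in>{..<n}. \<bar>f k x\<bar> > l}. z)"
    by (subst prod.inter_filter) auto
  thus ?thesis by (simp add: exceed_def)
qed

lemma ennreal_power_exceed:
  "z \<ge> 0 \<Longrightarrow> ennreal (z ^ exceed n f l x) = (\<Prod>k<n. if \<bar>f k x\<bar> > l then ennreal z else 1)"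
  by (subst ennreal_power[symmetric]) (auto simp: power_exceed)

lemma exceed_eq_0_iff: "exceed n f l x = 0 \<longleftrightarrow> (\<forall>k<n. \<not> \<bar>f k x\<bar> > l)"
  by (auto simp: exceed_def card_eq_0_iff)

lemma exceed_measurable [measurable]:
  assumes [measurable]: "\<And>k. k < n \<Longrightarrow> random_variable borel (f k)"
  shows "exceed n f l \<in> measurable M (count_space UNIV)"
proof -
  have "exceed n f l = (\<lambda>x. \<Sum>k<n. if \<bar>f k x\<bar> > l then 1 else 0)"
    unfolding exceed_def by (subst sum.inter_filter[symmetric]) (auto simp: fun_eq_iff)
  thus ?thesis by simp
qed

lemma indep_nn_integral_prod:
  fixes n :: nat
  assumes "indep_vars (\<lambda>_. borel) f {..<n}"
    and "\<And>k. k < n \<Longrightarrow> h k \<in> borel_measurable borel"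
  shows "(\<integral>\<^sup>+x. (\<Prod>k<n. h k (f k x)) \<partial>M) = (\<Prod>k<n. \<integral>\<^sup>+x. h k (f k x) \<partial>M)"
proof (rule indep_vars_nn_integral)
  show "indep_vars (\<lambda>_. borel) (\<lambda>k x. h k (f k x)) {..<n}"
    by (rule indep_vars_compose2[OF assms(1)]) (simp add: assms(2))
qed simp_all

lemma nn_integral_level_factor:
  fixes g :: "'a \<Rightarrow> real"
  assumes [measurable]: "random_variable borel g" and z: "z \<ge> 0"
  shows "(\<integral>\<^sup>+x. (if \<bar>g x\<bar> > l then ennreal z else 1) \<partial>M)
    \<le> ennreal (exp ((z - 1) * prob {x \<in> space M. \<bar>g x\<bar> > l}))"
proof -
  define A where "A = {x \<in> space M. \<bar>g x\<bar> > l}"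
  have A[measurable]: "A \<in> events" unfolding A_def by measurable
  have "(\<integral>\<^sup>+x. (if \<bar>g x\<bar> > l then ennreal z else 1) \<partial>M)
      = (\<integral>\<^sup>+x. ennreal z * indicator A x + indicator (space M - A) x \<partial>M)"
    by (intro nn_integral_cong) (auto simp: A_def indicator_def)
  also have "\<dots> = ennreal z * emeasure M A + emeasure M (space M - A)"
    by (simp add: nn_integral_add nn_integral_cmult_indicator)
  also have "\<dots> = ennreal (z * prob A + (1 - prob A))"
    using z by (simp add: emeasure_eq_measure prob_compl ennreal_mult'' ennreal_plus)
  also have "\<dots> \<le> ennreal (exp ((z - 1) * prob A))"
    using exp_ge_add_one_self[of "(z - 1) * prob A"]
    by (intro ennreal_leI) (simp add: algebra_simps)
  finally show ?thesis by (simp add: A_def)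
qed

text \<open>A sum of independent Bernoulli variables has exponential moments controlled by its mean
  alone, uniformly in the number of summands.\<close>

lemma nn_integral_power_exceed:
  assumes indep: "indep_vars (\<lambda>_. borel) f {..<n}" and z: "z \<ge> 0"
  shows "(\<integral>\<^sup>+x. ennreal (z ^ exceed n f l x) \<partial>M) \<le> ennreal (exp ((z - 1) * tail_sum n f l))"
proof -
  have rv: "random_variable borel (f k)" if "k < n" for k
    using indep that by (auto simp: indep_vars_def)
  have "(\<integral>\<^sup>+x. ennreal (z ^ exceed n f l x) \<partial>M)
      = (\<integral>\<^sup>+x. (\<Prod>k<n. if \<bar>f k x\<bar> > l then ennreal z else 1) \<partial>M)"
    by (simp only: ennreal_power_exceed[OF z])
  also have "\<dots> = (\<Prod>k<n. \<integral>\<^sup>+x. (if \<bar>f k x\<bar> > l then ennreal z else 1) \<partial>M)"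
    by (rule indep_nn_integral_prod[OF indep, where h = "\<lambda>k y. if \<bar>y\<bar> > l then ennreal z else 1"]) simp
  also have "\<dots> \<le> (\<Prod>k<n. ennreal (exp ((z - 1) * prob {x \<in> space M. \<bar>f k x\<bar> > l})))"
    by (intro prod_mono_ennreal nn_integral_level_factor rv z) simp
  also have "\<dots> = ennreal (exp ((z - 1) * tail_sum n f l))"
    by (simp add: prod_ennreal exp_sum tail_sum_def sum_distrib_left)
  finally show ?thesis .
qed

text \<open>Splitting off the factor that depends on \<open>f k\<close>, the remaining part of the count is
  independent of \<open>f k\<close> and its exponential moment is bounded as before.\<close>

lemma nn_integral_power_exceed_times:
  assumes indep: "indep_vars (\<lambda>_. borel) f {..<n}" and z: "z \<ge> 1"
    and g[measurable]: "g \<in> borel_measurable borel" and tail: "tail_sum n f l \<le> 1" and k: "k < n"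
    and g0: "\<And>y. \<bar>y\<bar> \<le> l \<Longrightarrow> g y = 0"
  shows "(\<integral>\<^sup>+x. ennreal (z ^ exceed n f l x) * g (f k x) \<partial>M)
    \<le> ennreal (z * exp (z - 1)) * (\<integral>\<^sup>+x. g (f k x) \<partial>M)"
proof -
  have rv[measurable]: "random_variable borel (f k)" if "k < n" for k
    using indep that by (auto simp: indep_vars_def)
  define w where "w y = (if \<bar>y\<bar> > l then ennreal z else 1)" for y
  define h where "h i y = w y * (if i = k then g y else 1)" for i y
  have w[measurable]: "w \<in> borel_measurable borel" unfolding w_def by simp
  have h[measurable]: "h i \<in> borel_measurable borel" for i unfolding h_def by simp
  have remove: "(\<Prod>i<n. u i) = u k * (\<Prod>i\<in>{..<n} - {k}. u i)" for u :: "nat \<Rightarrow> ennreal"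
    using k by (intro prod.remove) auto
  have "ennreal (z ^ exceed n f l x) * g (f k x) = (\<Prod>i<n. h i (f i x))" for x
  proof -
    have "(\<Prod>i<n. h i (f i x)) = (\<Prod>i<n. w (f i x)) * (\<Prod>i<n. if i = k then g (f i x) else 1)"
      by (simp add: h_def prod.distrib)
    also have "(\<Prod>i<n. if i = k then g (f i x) else 1) = g (f k x)"
      using k by (simp add: prod.delta)
    also have "(\<Prod>i<n. w (f i x)) = ennreal (z ^ exceed n f l x)"
      using z by (simp add: w_def ennreal_power_exceed)
    finally show ?thesis ..
  qed
  hence "(\<integral>\<^sup>+x. ennreal (z ^ exceed n f l x) * g (f k x) \<partial>M)
      = (\<integral>\<^sup>+x. (\<Prod>i<n. h i (f i x)) \<partial>M)" by simp
  also have "\<dots> = (\<Prod>i<n. \<integral>\<^sup>+x. h i (f i x) \<partial>M)"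
    by (rule indep_nn_integral_prod[OF indep]) simp
  also have "\<dots> = (\<integral>\<^sup>+x. h k (f k x) \<partial>M) * (\<Prod>i\<in>{..<n} - {k}. \<integral>\<^sup>+x. h i (f i x) \<partial>M)"
    by (rule remove)
  also have "\<dots> \<le> (ennreal z * (\<integral>\<^sup>+x. g (f k x) \<partial>M)) * ennreal (exp (z - 1))"
  proof (rule mult_mono)
    have "(\<integral>\<^sup>+x. h k (f k x) \<partial>M) = (\<integral>\<^sup>+x. ennreal z * g (f k x) \<partial>M)"
      using g0 by (intro nn_integral_cong) (auto simp: h_def w_def)
    also have "\<dots> = ennreal z * (\<integral>\<^sup>+x. g (f k x) \<partial>M)"
      using k by (intro nn_integral_cmult) simp
    finally show "(\<integral>\<^sup>+x. h k (f k x) \<partial>M) \<le> ennreal z * (\<integral>\<^sup>+x. g (f k x) \<partial>M)" by simp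
    have "(\<Prod>i\<in>{..<n} - {k}. \<integral>\<^sup>+x. h i (f i x) \<partial>M)
        \<le> (\<Prod>i\<in>{..<n} - {k}. ennreal (exp ((z - 1) * prob {x \<in> space M. \<bar>f i x\<bar> > l})))"
    proof (rule prod_mono_ennreal)
      fix i assume i: "i \<in> {..<n} - {k}"
      have "(\<integral>\<^sup>+x. h i (f i x) \<partial>M) = (\<integral>\<^sup>+x. (if \<bar>f i x\<bar> > l then ennreal z else 1) \<partial>M)"
        using i by (simp add: h_def w_def)
      thus "(\<integral>\<^sup>+x. h i (f i x) \<partial>M) \<le> ennreal (exp ((z - 1) * prob {x \<in> space M. \<bar>f i x\<bar> > l}))"
        using nn_integral_level_factor[OF rv, of i z l] i z by simp
    qed
    also have "\<dots> = ennreal (exp ((z - 1) * (\<Sum>i\<in>{..<n} - {k}. prob {x \<in> space M. \<bar>f i x\<bar> > l})))"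
      by (simp add: prod_ennreal exp_sum sum_distrib_left)
    also have "\<dots> \<le> ennreal (exp ((z - 1) * 1))"
    proof (intro ennreal_leI, subst exp_le_cancel_iff, rule mult_left_mono)
      have "(\<Sum>i\<in>{..<n} - {k}. prob {x \<in> space M. \<bar>f i x\<bar> > l}) \<le> tail_sum n f l"
        unfolding tail_sum_def by (intro sum_mono2) auto
      with tail show "(\<Sum>i\<in>{..<n} - {k}. prob {x \<in> space M. \<bar>f i x\<bar> > l}) \<le> 1" by simp
    qed (use z in simp)
    finally show "(\<Prod>i\<in>{..<n} - {k}. \<integral>\<^sup>+x. h i (f i x) \<partial>M) \<le> ennreal (exp (z - 1))" by simp
  qed auto
  also have "\<dots> = ennreal (z * exp (z - 1)) * (\<integral>\<^sup>+x. g (f k x) \<partial>M)"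
    using z by (simp add: ennreal_mult mult_ac)
  finally show ?thesis .
qed

text \<open>At \<open>z = 0\<close> the moment bound says that no \<open>\<bar>f k\<bar>\<close> exceeds \<open>l\<close> with probability at most
  \<open>exp (- tail_sum n f l)\<close>.\<close>

lemma prob_exceed_pos_ge:
  assumes indep: "indep_vars (\<lambda>_. borel) f {..<n}"
  shows "min 1 (tail_sum n f l) \<le> 2 * prob {x \<in> space M. \<exists>k<n. \<bar>f k x\<bar> > l}"
proof -
  have rv[measurable]: "random_variable borel (f k)" if "k < n" for k
    using indep that by (auto simp: indep_vars_def)
  define A where "A = {x \<in> space M. \<exists>k<n. \<bar>f k x\<bar> > l}"
  have "A = (\<Union>k<n. {x \<in> space M. \<bar>f k x\<bar> > l})" by (auto simp: A_def)
  hence A[measurable]: "A \<in> events" by (auto intro!: sets.finite_UN)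
  have "emeasure M (space M - A) = (\<integral>\<^sup>+x. indicator (space M - A) x \<partial>M)" by simp
  also have "\<dots> = (\<integral>\<^sup>+x. ennreal (0 ^ exceed n f l x) \<partial>M)"
    by (intro nn_integral_cong) (auto simp: A_def indicator_def power_0_left exceed_eq_0_iff)
  also have "\<dots> \<le> ennreal (exp (- tail_sum n f l))"
    using nn_integral_power_exceed[OF indep, of 0 l] by simp
  finally have "1 - prob A \<le> exp (- tail_sum n f l)"
    by (simp add: emeasure_eq_measure prob_compl)
  also define t where "t = min 1 (tail_sum n f l)"
  have "exp (- tail_sum n f l) \<le> exp (- t)" by (simp add: t_def)
  also have "exp (- t) \<le> 1 - t / 2"
  proof -
    have t: "0 \<le> t" "t \<le> 1" by (auto simp: t_def tail_sum_nonneg)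
    have "1 \<le> (1 + t) * (1 - t / 2)"
      using mult_nonneg_nonneg[of t "1 - t"] t by (simp add: algebra_simps)
    also have "\<dots> \<le> exp t * (1 - t / 2)"
      using t exp_ge_add_one_self[of t] by (intro mult_right_mono) auto
    finally show ?thesis by (simp add: exp_minus field_simps)
  qed
  finally show ?thesis by (simp add: t_def A_def)
qed

end

section \<open>Comparing integrals through distribution functions\<close>

lemma lborel_below_ennreal: "emeasure lborel {s. 0 \<le> s \<and> ennreal s < c} = c"
proof (cases c)
  case (real r)
  have "{s. 0 \<le> s \<and> ennreal s < c} = {0..<r}" using real by (auto simp: ennreal_less_iff)
  thus ?thesis using real by simp
next
  case top
  have set_eq: "{s. 0 \<le> s \<and> ennreal s < c} = {0::real..}" using top by auto
  show ?thesis
  proof (cases "emeasure lborel {0::real..}")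
    case (real r)
    have "ennreal (r + 1) = emeasure lborel {0..r + 1}" using real by simp
    also have "\<dots> \<le> emeasure lborel {0::real..}" by (intro emeasure_mono) auto
    finally show ?thesis using real by (simp add: ennreal_le_iff)
  next
    case top
    thus ?thesis unfolding set_eq using \<open>c = top\<close> by simp
  qed
qed

text \<open>The layer-cake formula reduces inequalities between integrals to inequalities between
  distribution functions. Its integrand is also shown to be measurable, as it has to be summed and
  scaled under the integral.\<close>

lemma (in sigma_finite_measure)
  assumes u[measurable]: "u \<in> borel_measurable M"
  shows nn_integral_layer_cake: "(\<integral>\<^sup>+x. u x \<partial>M)
      = (\<integral>\<^sup>+s. indicator {0..} s * emeasure M {x \<in> space M. ennreal s < u x} \<partial>lborel)" (is ?eq)
    and borel_measurable_layer_cake: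
      "(\<lambda>s. indicator {0..} s * emeasure M {x \<in> space M. ennreal s < u x}) \<in> borel_measurable lborel"
      (is ?meas)
proof -
  interpret P: pair_sigma_finite lborel M ..
  define F :: "real \<times> 'a \<Rightarrow> ennreal" where
    "F p = (if 0 \<le> fst p \<and> ennreal (fst p) < u (snd p) then 1 else 0)" for p
  have F[measurable]: "F \<in> borel_measurable (lborel \<Otimes>\<^sub>M M)"
    unfolding F_def by measurable
  have inner: "(\<integral>\<^sup>+x. F (s, x) \<partial>M)
      = indicator {0..} s * emeasure M {x \<in> space M. ennreal s < u x}" for s
  proof -
    have "(\<integral>\<^sup>+x. F (s, x) \<partial>M)
        = (\<integral>\<^sup>+x. indicator {0..} s * indicator {x \<in> space M. ennreal s < u x} x \<partial>M)"
      by (intro nn_integral_cong) (auto simp: F_def indicator_def)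
    thus ?thesis by (simp add: nn_integral_cmult_indicator)
  qed
  have "(\<integral>\<^sup>+s. F (s, x) \<partial>lborel) = u x" if x: "x \<in> space M" for x
  proof -
    have "(\<integral>\<^sup>+s. F (s, x) \<partial>lborel) = (\<integral>\<^sup>+s. indicator {s. 0 \<le> s \<and> ennreal s < u x} s \<partial>lborel)"
      by (intro nn_integral_cong) (auto simp: F_def indicator_def)
    also have "\<dots> = emeasure lborel {s. 0 \<le> s \<and> ennreal s < u x}" by simp
    finally show ?thesis by (simp add: lborel_below_ennreal)
  qed
  hence "(\<integral>\<^sup>+x. u x \<partial>M) = (\<integral>\<^sup>+x. (\<integral>\<^sup>+s. F (s, x) \<partial>lborel) \<partial>M)"
    by (intro nn_integral_cong) simp
  also have "\<dots> = (\<integral>\<^sup>+s. (\<integral>\<^sup>+x. F (s, x) \<partial>M) \<partial>lborel)"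
    by (rule P.Fubini[OF F])
  finally show ?eq by (simp only: inner)
  have "(\<lambda>s. \<integral>\<^sup>+x. F (s, x) \<partial>M) \<in> borel_measurable lborel" by measurable
  thus ?meas by (simp only: inner)
qed

locale orlicz_rearranged_tail = rearranged_tail M n f \<mu> + orlicz_function \<Phi>
  for M :: "'a measure" and n f \<mu> \<Phi> +
  assumes delta2: "Delta2 \<Phi>"
begin

lemma borel_measurable_\<Phi>_\<mu>:
  "(\<lambda>t. ennreal (\<Phi> (\<mu> t))) \<in> borel_measurable unit_interval_measure"
proof -
  have "(\<lambda>t. ennreal (\<Phi> \<bar>\<mu> t\<bar>)) \<in> borel_measurable unit_interval_measure"
    using measurable_compose[OF borel_measurable_\<mu> borel_measurable_abs] by measurable
  moreover have "\<Phi> \<bar>\<mu> t\<bar> = \<Phi> (\<mu> t)" if "t \<in> space unit_interval_measure" for t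
    using \<mu>_nonneg[of t] that by (simp add: space_restrict_space)
  ultimately show ?thesis by (subst measurable_cong[of _ _ "\<lambda>t. ennreal (\<Phi> \<bar>\<mu> t\<bar>)"]) auto
qed

lemma level_set_\<Phi>_\<mu>:
  assumes "s \<ge> 0" "\<And>x. x \<ge> 0 \<Longrightarrow> s < \<Phi> x \<longleftrightarrow> l < x"
  shows "{t \<in> space unit_interval_measure. ennreal s < ennreal (\<Phi> (\<mu> t))}
    = {t \<in> space unit_interval_measure. l < \<mu> t}"
  using assms \<mu>_nonneg by (auto simp: space_restrict_space ennreal_less_iff)

text \<open>Above the level \<open>\<mu> 1\<close> the functions \<open>f k\<close> have total tail at most \<open>min 1 \<circ> d\<close>,
  which is the tail of \<open>\<mu>\<close> on the unit interval.\<close>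

lemma sum_nn_integral_large_le:
  "(\<Sum>k<n. \<integral>\<^sup>+x. ennreal (if \<bar>f k x\<bar> > \<mu> 1 then \<Phi> \<bar>f k x\<bar> else 0) \<partial>M)
    \<le> (\<integral>\<^sup>+t. ennreal (\<Phi> (\<mu> t)) \<partial>unit_interval_measure)"
proof -
  interpret U: prob_space unit_interval_measure by (rule prob_space_unit_interval_measure)
  define u where "u k x = ennreal (if \<bar>f k x\<bar> > \<mu> 1 then \<Phi> \<bar>f k x\<bar> else 0)" for k x
  have u: "u k \<in> borel_measurable M" if "k < n" for k
  proof -
    have [measurable]: "random_variable borel (f k)" using rv that .
    show ?thesis unfolding u_def by measurable
  qed
  have "(\<Sum>k<n. \<integral>\<^sup>+x. u k x \<partial>M)
      = (\<Sum>k<n. \<integral>\<^sup>+s. indicator {0..} s * emeasure M {x \<in> space M. ennreal s < u k x} \<partial>lborel)"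
    by (intro sum.cong nn_integral_layer_cake u) auto
  also have "\<dots> = (\<integral>\<^sup>+s. (\<Sum>k<n. indicator {0..} s * emeasure M {x \<in> space M. ennreal s < u k x}) \<partial>lborel)"
    by (intro nn_integral_sum[symmetric] borel_measurable_layer_cake u) auto
  also have "\<dots> \<le> (\<integral>\<^sup>+s. indicator {0..} s * emeasure unit_interval_measure
      {t \<in> space unit_interval_measure. ennreal s < ennreal (\<Phi> (\<mu> t))} \<partial>lborel)"
  proof (rule nn_integral_mono)
    fix s :: real
    show "(\<Sum>k<n. indicator {0..} s * emeasure M {x \<in> space M. ennreal s < u k x})
      \<le> indicator {0..} s * emeasure unit_interval_measure
        {t \<in> space unit_interval_measure. ennreal s < ennreal (\<Phi> (\<mu> t))}"
    proof (cases "s \<ge> 0")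
      case True
      then obtain l where l: "l \<ge> 0" "\<And>x. x \<ge> 0 \<Longrightarrow> s < \<Phi> x \<longleftrightarrow> l < x"
        using level_iff[OF delta2] by metis
      have "{x \<in> space M. ennreal s < u k x} = {x \<in> space M. \<bar>f k x\<bar> > max (\<mu> 1) l}" for k
        using True l by (auto simp: u_def ennreal_less_iff)
      hence "(\<Sum>k<n. emeasure M {x \<in> space M. ennreal s < u k x}) = ennreal (d (max (\<mu> 1) l))"
        by (simp add: tail_sum_def emeasure_eq_measure sum_ennreal)
      also have "\<dots> \<le> ennreal (min 1 (d l))"
        using d_antimono[of "\<mu> 1" "max (\<mu> 1) l"] d_antimono[of l "max (\<mu> 1) l"] d_\<mu>_le[of 1]
        by (intro ennreal_leI) auto
      also have "\<dots> \<le> emeasure unit_interval_measure {t \<in> space unit_interval_measure. l < \<mu> t}"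
        by (rule emeasure_\<mu>_gt_ge[OF l(1)])
      finally show ?thesis
        using True by (subst level_set_\<Phi>_\<mu>[where l = l]) (auto simp: l(2))
    qed simp
  qed
  also have "\<dots> = (\<integral>\<^sup>+t. ennreal (\<Phi> (\<mu> t)) \<partial>unit_interval_measure)"
    by (rule U.nn_integral_layer_cake[symmetric, OF borel_measurable_\<Phi>_\<mu>])
  finally show ?thesis by (simp add: u_def)
qed

text \<open>The maximum of the \<open>\<bar>f k\<bar>\<close> has a distribution function at least half that of \<open>\<mu>\<close> on the
  unit interval.\<close>

lemma nn_integral_\<mu>_le_max:
  assumes indep: "indep_vars (\<lambda>_. borel) f {..<n}"
  shows "(\<integral>\<^sup>+t. ennreal (\<Phi> (\<mu> t)) \<partial>unit_interval_measure)
    \<le> 2 * (\<integral>\<^sup>+x. (SUP k\<in>{..<n}. ennreal (\<Phi> \<bar>f k x\<bar>)) \<partial>M)"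
proof -
  interpret U: prob_space unit_interval_measure by (rule prob_space_unit_interval_measure)
  define v where "v x = (SUP k\<in>{..<n}. ennreal (\<Phi> \<bar>f k x\<bar>))" for x
  have v: "v \<in> borel_measurable M"
    unfolding v_def
  proof (rule borel_measurable_SUP)
    fix k assume "k \<in> {..<n}"
    hence [measurable]: "random_variable borel (f k)" using rv by simp
    show "(\<lambda>x. ennreal (\<Phi> \<bar>f k x\<bar>)) \<in> borel_measurable M" by measurable
  qed simp
  have "(\<integral>\<^sup>+t. ennreal (\<Phi> (\<mu> t)) \<partial>unit_interval_measure)
      = (\<integral>\<^sup>+s. indicator {0..} s * emeasure unit_interval_measure
        {t \<in> space unit_interval_measure. ennreal s < ennreal (\<Phi> (\<mu> t))} \<partial>lborel)"
    by (rule U.nn_integral_layer_cake[OF borel_measurable_\<Phi>_\<mu>])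
  also have "\<dots> \<le> (\<integral>\<^sup>+s. 2 * (indicator {0..} s * emeasure M {x \<in> space M. ennreal s < v x}) \<partial>lborel)"
  proof (rule nn_integral_mono)
    fix s :: real
    show "indicator {0..} s * emeasure unit_interval_measure
        {t \<in> space unit_interval_measure. ennreal s < ennreal (\<Phi> (\<mu> t))}
      \<le> 2 * (indicator {0..} s * emeasure M {x \<in> space M. ennreal s < v x})"
    proof (cases "s \<ge> 0")
      case True
      then obtain l where l: "l \<ge> 0" "\<And>x. x \<ge> 0 \<Longrightarrow> s < \<Phi> x \<longleftrightarrow> l < x"
        using level_iff[OF delta2] by metis
      have eq: "{x \<in> space M. ennreal s < v x} = {x \<in> space M. \<exists>k<n. \<bar>f k x\<bar> > l}"
        using True l by (auto simp: v_def less_SUP_iff ennreal_less_iff)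
      have "emeasure unit_interval_measure {t \<in> space unit_interval_measure. l < \<mu> t}
          \<le> ennreal (min 1 (d l))"
        by (rule emeasure_\<mu>_gt_le[OF l(1)])
      also have "\<dots> \<le> ennreal (2 * prob {x \<in> space M. \<exists>k<n. \<bar>f k x\<bar> > l})"
        by (intro ennreal_leI prob_exceed_pos_ge indep)
      also have "\<dots> = 2 * emeasure M {x \<in> space M. ennreal s < v x}"
        by (simp add: eq emeasure_eq_measure ennreal_mult')
      finally show ?thesis
        using True by (subst level_set_\<Phi>_\<mu>[where l = l]) (auto simp: l(2))
    qed simp
  qed
  also have "\<dots> = 2 * (\<integral>\<^sup>+x. v x \<partial>M)"
    by (subst nn_integral_cmult[OF borel_measurable_layer_cake[OF v]],
      subst nn_integral_layer_cake[OF v], rule refl)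
  finally show ?thesis by (simp add: v_def)
qed

end

section \<open>Domination of the counting functions\<close>

lemma downward_level_set:
  fixes \<beta> :: "nat \<Rightarrow> real"
  assumes "\<And>i j. i \<le> j \<Longrightarrow> \<beta> j \<le> \<beta> i"
  shows "{k. k < n \<and> \<beta> k > l} = {..<card {k. k < n \<and> \<beta> k > l}}"
proof -
  define S where "S = {k. k < n \<and> \<beta> k > l}"
  define m where "m = (LEAST k. k \<notin> S)"
  have m: "m \<notin> S" unfolding m_def by (rule LeastI[of _ n]) (simp add: S_def)
  have "k \<in> S" if "k < m" for k using not_less_Least that unfolding m_def by blast
  moreover have "k < m" if "k \<in> S" for k
  proof (rule ccontr)
    assume "\<not> k < m"
    with that assms[of m k] have "m \<in> S" by (auto simp: S_def)
    with m show False ..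
  qed
  ultimately have "S = {..<m}" by auto
  thus ?thesis by (simp add: S_def)
qed

lemma geometric_sum_le:
  fixes q :: real
  assumes "0 \<le> q" "q < 1"
  shows "(\<Sum>j=1..n. q ^ j) \<le> q / (1 - q)"
proof -
  have "(1 - q) * (\<Sum>j=1..n. q ^ j) = q - q ^ Suc n"
  proof (induction n)
    case (Suc n)
    have "(1 - q) * (\<Sum>j=1..Suc n. q ^ j) = (1 - q) * (\<Sum>j=1..n. q ^ j) + (1 - q) * q ^ Suc n"
      by (simp add: distrib_left)
    also have "\<dots> = q - q ^ Suc (Suc n)" unfolding Suc by (simp add: algebra_simps)
    finally show ?case .
  qed simp
  also have "\<dots> \<le> q" using assms by simp
  finally show ?thesis using assms by (simp add: pos_le_divide_eq mult.commute)
qed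

text \<open>The least integer \<open>r\<close> with \<open>S j \<le> r j\<close> for all \<open>j\<close> has exponential moments if the \<open>S j\<close> do:
  if \<open>r\<close> exceeds \<open>m\<close>, then some \<open>S j\<close> exceeds \<open>(r - 1) j\<close>, hence \<open>r - 1 + m j \<le> 2 S j\<close>. The
  factor \<open>Q ^ (m * j)\<close> in the denominator makes the expectations of the summands summable over
  \<open>j\<close>.\<close>

lemma uniform_ratio_power_bound:
  fixes S :: "nat \<Rightarrow> nat" and Q :: real
  assumes Q: "Q \<ge> 1" and m: "m \<ge> 1"
  obtains r where "r \<ge> 1" "\<And>j. j \<in> {1..n} \<Longrightarrow> S j \<le> r * j"
    "Q ^ r \<le> Q ^ m + (\<Sum>j=1..n. Q / Q ^ (m * j) * (Q\<^sup>2) ^ S j)"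
proof -
  define P where "P r \<longleftrightarrow> (\<forall>j\<in>{1..n}. S j \<le> r * j)" for r
  have sum_nonneg: "(\<Sum>j=1..n. Q / Q ^ (m * j) * (Q\<^sup>2) ^ S j) \<ge> 0"
    using Q by (intro sum_nonneg) auto
  have "P (\<Sum>j\<in>{1..n}. S j)"
    unfolding P_def
  proof
    fix j assume j: "j \<in> {1..n}"
    have "S j \<le> (\<Sum>j\<in>{1..n}. S j)" using j by (intro member_le_sum) auto
    also have "\<dots> \<le> (\<Sum>j\<in>{1..n}. S j) * j" using j by simp
    finally show "S j \<le> (\<Sum>j\<in>{1..n}. S j) * j" .
  qed
  define r where "r = (LEAST r. P r)"
  have r: "P r" unfolding r_def by (rule LeastI) fact
  show ?thesis
  proof (cases "r \<le> m")
    case True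
    show ?thesis
    proof (rule that[of m])
      show "S j \<le> m * j" if "j \<in> {1..n}" for j
        using r that mult_le_mono1[OF True, of j] unfolding P_def by (meson order_trans)
    qed (use m sum_nonneg in auto)
  next
    case False
    have "\<not> P (r - 1)" using not_less_Least[of "r - 1" P] False by (simp add: r_def)
    then obtain j where j: "j \<in> {1..n}" "S j > (r - 1) * j" by (auto simp: P_def not_le)
    have "m * j \<le> (r - 1) * j" "(r - 1) * 1 \<le> (r - 1) * j"
      using False j by (auto intro!: mult_le_mono)
    with j(2) have "r - 1 + m * j \<le> 2 * S j" by linarith
    hence "Q ^ (r - 1 + m * j) \<le> Q ^ (2 * S j)" using Q by (rule power_increasing)
    hence "Q ^ (r - 1) \<le> (Q\<^sup>2) ^ S j / Q ^ (m * j)"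
      using Q unfolding power_mult[symmetric] by (simp add: power_add field_simps)
    hence "Q * Q ^ (r - 1) \<le> Q * ((Q\<^sup>2) ^ S j / Q ^ (m * j))"
      using Q by (intro mult_left_mono) auto
    also have "Q * Q ^ (r - 1) = Q ^ r" using False by (simp add: power_eq_if)
    also have "Q * ((Q\<^sup>2) ^ S j / Q ^ (m * j)) = Q / Q ^ (m * j) * (Q\<^sup>2) ^ S j" by simp
    also have "\<dots> \<le> (\<Sum>j=1..n. Q / Q ^ (m * j) * (Q\<^sup>2) ^ S j)"
      using j(1) Q by (intro member_le_sum) auto
    finally have "Q ^ r \<le> Q ^ m + (\<Sum>j=1..n. Q / Q ^ (m * j) * (Q\<^sup>2) ^ S j)"
      using Q by (simp add: add_increasing)
    with False r that[of r] show ?thesis by (simp add: P_def)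
  qed
qed

context rearranged_tail
begin

definition \<beta> :: "nat \<Rightarrow> real" where
  "\<beta> k = \<mu> (real (Suc k))"

lemma \<beta>_nonneg: "\<beta> k \<ge> 0"
  unfolding \<beta>_def by (rule \<mu>_nonneg) simp

lemma \<beta>_antimono: "i \<le> j \<Longrightarrow> \<beta> j \<le> \<beta> i"
  unfolding \<beta>_def by (rule \<mu>_antimono) auto

lemma \<beta>_level_set:
  assumes "l \<ge> 0"
  shows "{k. k < n \<and> \<beta> k > l} = {..<level_count (finite_seq n \<beta>) l}"
  using downward_level_set[of \<beta> n l] \<beta>_antimono \<beta>_nonneg assms
  by (simp add: level_count_finite_seq)

lemma exceed_antimono: "l \<le> l' \<Longrightarrow> exceed n f l' x \<le> exceed n f l x"
  unfolding exceed_def by (intro card_mono) auto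

lemma exceed_le: "exceed n f l x \<le> n"
  unfolding exceed_def using card_mono[of "{..<n}" "{k. k < n \<and> \<bar>f k x\<bar> > l}"] by auto

lemma level_count_f: "l \<ge> 0 \<Longrightarrow> level_count (finite_seq n (\<lambda>k. f k x)) l = exceed n f l x"
  by (simp add: level_count_finite_seq exceed_def)

text \<open>If \<open>J\<close> entries of \<open>\<beta>\<close> exceed \<open>l < \<mu> 1\<close>, then \<open>\<mu> (J + 1) \<le> l\<close> unless \<open>J = n\<close>, so at most
  \<open>r (J + 1) \<le> 2 r J\<close> of the \<open>f k x\<close> exceed \<open>l\<close>.\<close>

lemma level_count_small_le:
  assumes r: "r \<ge> 1" and le: "\<And>j. j \<in> {1..n} \<Longrightarrow> exceed n f (\<mu> (real j)) x \<le> r * j" and l: "l \<ge> 0"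
  shows "level_count (finite_seq n (\<lambda>k. if \<bar>f k x\<bar> \<le> \<mu> 1 then f k x else 0)) l
    \<le> (2 * r) * level_count (finite_seq n \<beta>) l"
proof -
  define J where "J = level_count (finite_seq n \<beta>) l"
  define W where "W = {k. k < n \<and> \<bar>if \<bar>f k x\<bar> \<le> \<mu> 1 then f k x else 0\<bar> > l}"
  have W_count: "card W = level_count (finite_seq n (\<lambda>k. if \<bar>f k x\<bar> \<le> \<mu> 1 then f k x else 0)) l"
    by (simp only: W_def level_count_finite_seq[OF l])
  note seg = \<beta>_level_set[OF l, folded J_def]
  have W_le: "card W \<le> exceed n f l x"
    unfolding exceed_def W_def using l by (intro card_mono) (auto split: if_splits)
  have "card W \<le> (2 * r) * J"
  proof (cases "n = 0 \<or> l \<ge> \<mu> 1")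
    case True
    hence "W = {}" using l by (auto simp: W_def split: if_splits)
    thus ?thesis by simp
  next
    case False
    hence "0 \<in> {k. k < n \<and> \<beta> k > l}" by (simp add: \<beta>_def)
    hence J1: "J \<ge> 1" unfolding seg by simp
    show ?thesis
    proof (cases "J \<ge> n")
      case True
      have "card W \<le> 1 * n" using W_le exceed_le[of l x] by simp
      also have "\<dots> \<le> (2 * r) * J" using r True by (intro mult_le_mono) auto
      finally show ?thesis .
    next
      case False
      have "J \<notin> {k. k < n \<and> \<beta> k > l}" unfolding seg by simp
      with False have "\<mu> (real (Suc J)) \<le> l" by (simp add: \<beta>_def)
      hence "exceed n f l x \<le> exceed n f (\<mu> (real (Suc J))) x" by (rule exceed_antimono)
      also have "\<dots> \<le> r * Suc J" using False by (intro le) auto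
      also have "\<dots> \<le> r * (2 * J)" using J1 by (intro mult_le_mono) auto
      finally show ?thesis using W_le by simp
    qed
  qed
  thus ?thesis by (simp add: W_count J_def)
qed

lemma level_count_half_\<beta>_le:
  assumes ge: "\<And>j. j \<in> {1..n} \<Longrightarrow> \<mu> (real j) > 0 \<Longrightarrow> j \<le> m * exceed n f (\<mu> (real j) / 2) x"
    and l: "l \<ge> 0"
  shows "level_count (finite_seq n (\<lambda>k. \<beta> k / 2)) l \<le> m * level_count (finite_seq n (\<lambda>k. f k x)) l"
proof -
  define J where "J = level_count (finite_seq n \<beta>) (2 * l)"
  have l2: "2 * l \<ge> 0" using l by simp
  note seg = \<beta>_level_set[OF l2, folded J_def]
  have eq: "level_count (finite_seq n (\<lambda>k. \<beta> k / 2)) l = J"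
    unfolding J_def level_count_finite_seq[OF l] level_count_finite_seq[OF l2]
    by (simp add: field_simps)
  have "J \<le> m * exceed n f l x"
  proof (cases "J = 0")
    case False
    hence "J - 1 \<in> {k. k < n \<and> \<beta> k > 2 * l}" unfolding seg by simp
    hence J: "J \<in> {1..n}" "\<mu> (real J) > 2 * l" using False by (auto simp: \<beta>_def of_nat_diff)
    have "J \<le> m * exceed n f (\<mu> (real J) / 2) x" using J l by (intro ge) auto
    also have "\<dots> \<le> m * exceed n f l x" using J by (intro mult_le_mono exceed_antimono) auto
    finally show ?thesis .
  qed simp
  thus ?thesis by (simp add: eq level_count_f[OF l])
qed

end

section \<open>The two-sided estimate\<close>

text \<open>The constants \<open>K\<close>, \<open>D\<close> and \<open>m\<close> are parameters because they depend on \<open>E\<close>, \<open>N\<close> and \<open>\<Phi>\<close> but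
  not on \<open>n\<close> and \<open>f\<close>; bounds in terms of them are uniform. The condition on \<open>m\<close> makes the expected
  values of the summands in \<open>uniform_ratio_power_bound\<close>, taken with \<open>Q = D\<^sup>2\<close>, decay like
  \<open>(1 / 2) ^ j\<close>.\<close>

locale independent_tail_in_sequence_space =
  orlicz_rearranged_tail M n f \<mu> \<Phi> + symmetric_quasi_banach_sequence_space E N
  for M :: "'a measure" and n f \<mu> \<Phi> E N +
  fixes K D :: real and m :: nat
  assumes indep: "indep_vars (\<lambda>_. borel) f {..<n}"
    and K: "K \<ge> 2"
    and N_add_le: "\<And>a b. a \<in> E \<Longrightarrow> b \<in> E \<Longrightarrow> N (\<lambda>k. a k + b k) \<le> K * max (N a) (N b)"
    and N_dilation_le: "\<And>y b j. finite {k. y k \<noteq> 0} \<Longrightarrow> finite {k. b k \<noteq> 0} \<Longrightarrow>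
      (\<And>l. l \<ge> 0 \<Longrightarrow> level_count y l \<le> j * level_count b l) \<Longrightarrow> N y \<le> K ^ j * N b"
    and D: "D \<ge> 2"
    and \<Phi>_dilation_le: "\<And>t j. t \<ge> 0 \<Longrightarrow> \<Phi> (K ^ j * t) \<le> D ^ j * \<Phi> t"
    and m: "m \<ge> 1" "2 * exp (((D\<^sup>2)\<^sup>2) - 1) \<le> (D\<^sup>2) ^ m"
begin

lemma N_finite_seq_nonneg: "N (finite_seq n a) \<ge> 0"
  by (intro N_nonneg finite_seq_mem)

lemma \<Phi>_N_le:
  assumes "\<And>l. l \<ge> 0 \<Longrightarrow> level_count (finite_seq n y) l \<le> j * level_count b l" "finite {k. b k \<noteq> 0}"
  shows "\<Phi> (N (finite_seq n y)) \<le> D ^ j * \<Phi> (N b)"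
proof -
  have "\<Phi> (N (finite_seq n y)) \<le> \<Phi> (K ^ j * N b)"
    by (intro mono N_finite_seq_nonneg N_dilation_le finite_seq_support assms)
  also have "\<dots> \<le> D ^ j * \<Phi> (N b)"
    by (intro \<Phi>_dilation_le N_nonneg finite_support_mem assms)
  finally show ?thesis .
qed

text \<open>The large values are few: their number has mean at most one. Their sequence is dominated by
  that many copies of its largest entry.\<close>

lemma \<Phi>_large_le:
  "\<Phi> (N (finite_seq n (\<lambda>k. if \<bar>f k x\<bar> > \<mu> 1 then f k x else 0)))
    \<le> (\<Sum>k<n. D ^ exceed n f (\<mu> 1) x * (if \<bar>f k x\<bar> > \<mu> 1 then \<Phi> \<bar>f k x\<bar> else 0))"
proof -
  define Y where "Y k = (if \<bar>f k x\<bar> > \<mu> 1 then f k x else 0)" for k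
  define G where "G k = (if \<bar>f k x\<bar> > \<mu> 1 then \<Phi> \<bar>f k x\<bar> else 0)" for k
  have G: "G k \<ge> 0" "\<Phi> \<bar>Y k\<bar> = G k" for k
    by (auto simp: G_def Y_def nonneg zero)
  have "\<Phi> (N (finite_seq n Y)) \<le> (\<Sum>k<n. D ^ exceed n f (\<mu> 1) x * G k)"
  proof (cases "n = 0")
    case True
    thus ?thesis by (simp add: finite_seq_def N_zero zero)
  next
    case False
    define y where "y = Max ((\<lambda>k. \<bar>Y k\<bar>) ` {..<n})"
    have "y \<in> (\<lambda>k. \<bar>Y k\<bar>) ` {..<n}" unfolding y_def using False by (intro Max_in) auto
    then obtain i where i: "i < n" "y = \<bar>Y i\<bar>" by auto
    have y_max: "\<bar>Y k\<bar> \<le> y" if "k < n" for k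
      unfolding y_def using that by (intro Max_ge) auto
    define b where "b k = y * unit_seq 0 k" for k
    have b_fin: "finite {k. b k \<noteq> 0}"
      by (rule finite_subset[of _ "{0}"]) (auto simp: b_def unit_seq_def)
    have N_b: "N b = y"
      unfolding b_def using N_scale[OF unit_seq_mem, of y 0] N_unit_seq i by simp
    have "\<Phi> (N (finite_seq n Y)) \<le> D ^ exceed n f (\<mu> 1) x * \<Phi> (N b)"
    proof (rule \<Phi>_N_le[OF _ b_fin])
      fix l :: real assume l: "l \<ge> 0"
      show "level_count (finite_seq n Y) l \<le> exceed n f (\<mu> 1) x * level_count b l"
      proof (cases "l < y")
        case True
        hence "{k. \<bar>b k\<bar> > l} = {0}" using l by (auto simp: b_def unit_seq_def)
        hence "level_count b l = 1" by (simp add: level_count_def)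
        moreover have "level_count (finite_seq n Y) l \<le> exceed n f (\<mu> 1) x"
          unfolding level_count_finite_seq[OF l] exceed_def using l
          by (intro card_mono) (auto simp: Y_def split: if_splits)
        ultimately show ?thesis by simp
      next
        case False
        hence empty: "{k. k < n \<and> \<bar>Y k\<bar> > l} = {}" using y_max by fastforce
        show ?thesis unfolding level_count_finite_seq[OF l] empty by simp
      qed
    qed
    also have "\<dots> = D ^ exceed n f (\<mu> 1) x * G i" using N_b i G by simp
    also have "\<dots> \<le> (\<Sum>k<n. D ^ exceed n f (\<mu> 1) x * G k)"
      using i D G by (intro member_le_sum) auto
    finally show ?thesis .
  qed
  thus ?thesis by (simp only: Y_def[abs_def] G_def)
qed

text \<open>Here \<open>D ^ (2 * r)\<close>, with the random ratio \<open>r\<close> of \<open>uniform_ratio_power_bound\<close>, is already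
  replaced by an explicit measurable majorant.\<close>

lemma \<Phi>_small_le:
  "\<Phi> (N (finite_seq n (\<lambda>k. if \<bar>f k x\<bar> \<le> \<mu> 1 then f k x else 0)))
    \<le> ((D\<^sup>2) ^ m + (\<Sum>j=1..n. D\<^sup>2 / (D\<^sup>2) ^ (m * j) * ((D\<^sup>2)\<^sup>2) ^ exceed n f (\<mu> (real j)) x))
      * \<Phi> (N (finite_seq n \<beta>))"
proof -
  have "D\<^sup>2 \<ge> 1" using D by (simp add: one_le_power)
  from uniform_ratio_power_bound[OF this m(1), of n "\<lambda>j. exceed n f (\<mu> (real j)) x"]
  obtain r where r: "r \<ge> 1" "\<And>j. j \<in> {1..n} \<Longrightarrow> exceed n f (\<mu> (real j)) x \<le> r * j"
    "(D\<^sup>2) ^ r \<le> (D\<^sup>2) ^ m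
      + (\<Sum>j=1..n. D\<^sup>2 / (D\<^sup>2) ^ (m * j) * ((D\<^sup>2)\<^sup>2) ^ exceed n f (\<mu> (real j)) x)"
    by blast
  have "\<Phi> (N (finite_seq n (\<lambda>k. if \<bar>f k x\<bar> \<le> \<mu> 1 then f k x else 0)))
      \<le> D ^ (2 * r) * \<Phi> (N (finite_seq n \<beta>))"
    by (intro \<Phi>_N_le finite_seq_support level_count_small_le r)
  also have "\<dots> = (D\<^sup>2) ^ r * \<Phi> (N (finite_seq n \<beta>))" by (simp add: power_mult)
  also have "\<dots> \<le> ((D\<^sup>2) ^ m
      + (\<Sum>j=1..n. D\<^sup>2 / (D\<^sup>2) ^ (m * j) * ((D\<^sup>2)\<^sup>2) ^ exceed n f (\<mu> (real j)) x))
      * \<Phi> (N (finite_seq n \<beta>))"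
    by (intro mult_right_mono r nonneg N_finite_seq_nonneg)
  finally show ?thesis .
qed

lemma nn_integral_large_le:
  "(\<integral>\<^sup>+x. (\<Sum>k<n. ennreal (D ^ exceed n f (\<mu> 1) x * (if \<bar>f k x\<bar> > \<mu> 1 then \<Phi> \<bar>f k x\<bar> else 0))) \<partial>M)
    \<le> ennreal (D * exp (D - 1)) * (\<integral>\<^sup>+t. ennreal (\<Phi> (\<mu> t)) \<partial>unit_interval_measure)"
proof -
  define g where "g y = ennreal (if \<bar>y\<bar> > \<mu> 1 then \<Phi> \<bar>y\<bar> else 0)" for y
  have g[measurable]: "g \<in> borel_measurable borel" unfolding g_def by measurable
  have fact: "ennreal (D ^ exceed n f (\<mu> 1) x * (if \<bar>f k x\<bar> > \<mu> 1 then \<Phi> \<bar>f k x\<bar> else 0))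
      = ennreal (D ^ exceed n f (\<mu> 1) x) * g (f k x)" for k x
    using D by (simp add: g_def ennreal_mult nonneg)
  have "(\<integral>\<^sup>+x. (\<Sum>k<n. ennreal (D ^ exceed n f (\<mu> 1) x) * g (f k x)) \<partial>M)
      = (\<Sum>k<n. \<integral>\<^sup>+x. ennreal (D ^ exceed n f (\<mu> 1) x) * g (f k x) \<partial>M)"
  proof (rule nn_integral_sum)
    fix k assume "k \<in> {..<n}"
    hence [measurable]: "random_variable borel (f k)" using rv by simp
    show "(\<lambda>x. ennreal (D ^ exceed n f (\<mu> 1) x) * g (f k x)) \<in> borel_measurable M"
      using exceed_measurable[where f = f and n = n, OF rv] by measurable
  qed
  also have "\<dots> \<le> (\<Sum>k<n. ennreal (D * exp (D - 1)) * (\<integral>\<^sup>+x. g (f k x) \<partial>M))"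
    using D d_\<mu>_le[of 1] by (intro sum_mono nn_integral_power_exceed_times indep g) (auto simp: g_def)
  also have "\<dots> = ennreal (D * exp (D - 1)) * (\<Sum>k<n. \<integral>\<^sup>+x. g (f k x) \<partial>M)"
    by (rule sum_distrib_left[symmetric])
  also have "\<dots> \<le> ennreal (D * exp (D - 1)) * (\<integral>\<^sup>+t. ennreal (\<Phi> (\<mu> t)) \<partial>unit_interval_measure)"
    using sum_nn_integral_large_le by (intro mult_left_mono) (auto simp: g_def)
  finally show ?thesis by (simp only: fact)
qed

lemma nn_integral_uniform_ratio_le:
  "(\<integral>\<^sup>+x. ennreal ((D\<^sup>2) ^ m
      + (\<Sum>j=1..n. D\<^sup>2 / (D\<^sup>2) ^ (m * j) * ((D\<^sup>2)\<^sup>2) ^ exceed n f (\<mu> (real j)) x)) \<partial>M)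
    \<le> ennreal ((D\<^sup>2) ^ m + D\<^sup>2)"
proof -
  define Q where "Q = D\<^sup>2"
  have Q: "Q \<ge> 1" unfolding Q_def using D by (simp add: one_le_power)
  have Qm: "2 * exp (Q\<^sup>2 - 1) \<le> Q ^ m" using m(2) by (simp add: Q_def)
  have meas: "(\<lambda>x. ennreal (z ^ exceed n f l x)) \<in> borel_measurable M" for z l
    using exceed_measurable[where f = f and n = n, OF rv] by measurable
  have "(\<integral>\<^sup>+x. ennreal (Q ^ m + (\<Sum>j=1..n. Q / Q ^ (m * j) * (Q\<^sup>2) ^ exceed n f (\<mu> (real j)) x)) \<partial>M)
      = (\<integral>\<^sup>+x. ennreal (Q ^ m)
        + (\<Sum>j=1..n. ennreal (Q / Q ^ (m * j)) * ennreal ((Q\<^sup>2) ^ exceed n f (\<mu> (real j)) x)) \<partial>M)"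
  proof (rule nn_integral_cong)
    fix x
    have prod: "ennreal (Q / Q ^ (m * j)) * ennreal ((Q\<^sup>2) ^ i)
        = ennreal (Q / Q ^ (m * j) * (Q\<^sup>2) ^ i)" for i j
      using Q by (intro ennreal_mult[symmetric]) auto
    have "(\<Sum>j=1..n. ennreal (Q / Q ^ (m * j)) * ennreal ((Q\<^sup>2) ^ exceed n f (\<mu> (real j)) x))
        = ennreal (\<Sum>j=1..n. Q / Q ^ (m * j) * (Q\<^sup>2) ^ exceed n f (\<mu> (real j)) x)"
      unfolding prod using Q by (intro sum_ennreal) auto
    thus "ennreal (Q ^ m + (\<Sum>j=1..n. Q / Q ^ (m * j) * (Q\<^sup>2) ^ exceed n f (\<mu> (real j)) x))
        = ennreal (Q ^ m)
          + (\<Sum>j=1..n. ennreal (Q / Q ^ (m * j)) * ennreal ((Q\<^sup>2) ^ exceed n f (\<mu> (real j)) x))"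
      using Q by (simp add: ennreal_plus sum_nonneg)
  qed
  also have "\<dots> = ennreal (Q ^ m) + (\<Sum>j=1..n. ennreal (Q / Q ^ (m * j))
      * (\<integral>\<^sup>+x. ennreal ((Q\<^sup>2) ^ exceed n f (\<mu> (real j)) x) \<partial>M))"
    using meas by (simp add: nn_integral_add nn_integral_sum nn_integral_cmult emeasure_space_1)
  also have "\<dots> \<le> ennreal (Q ^ m) + (\<Sum>j=1..n. ennreal (Q * (1 / 2) ^ j))"
  proof (intro add_left_mono sum_mono)
    fix j assume j: "j \<in> {1..n}"
    have "(\<integral>\<^sup>+x. ennreal ((Q\<^sup>2) ^ exceed n f (\<mu> (real j)) x) \<partial>M)
        \<le> ennreal (exp ((Q\<^sup>2 - 1) * d (\<mu> (real j))))"
      by (intro nn_integral_power_exceed indep) simp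
    also have "\<dots> \<le> ennreal ((Q ^ m / 2) ^ j)"
    proof (rule ennreal_leI)
      have "exp ((Q\<^sup>2 - 1) * d (\<mu> (real j))) \<le> exp ((Q\<^sup>2 - 1) * real j)"
        using d_\<mu>_le[of "real j"] j Q by (subst exp_le_cancel_iff, intro mult_left_mono) auto
      also have "\<dots> = exp (Q\<^sup>2 - 1) ^ j" by (simp add: exp_of_nat2_mult)
      also have "\<dots> \<le> (Q ^ m / 2) ^ j" using Qm by (intro power_mono) auto
      finally show "exp ((Q\<^sup>2 - 1) * d (\<mu> (real j))) \<le> (Q ^ m / 2) ^ j" .
    qed
    finally have "ennreal (Q / Q ^ (m * j)) * (\<integral>\<^sup>+x. ennreal ((Q\<^sup>2) ^ exceed n f (\<mu> (real j)) x) \<partial>M)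
        \<le> ennreal (Q / Q ^ (m * j)) * ennreal ((Q ^ m / 2) ^ j)"
      by (rule mult_left_mono) simp
    also have "\<dots> = ennreal (Q / Q ^ (m * j) * (Q ^ m / 2) ^ j)"
      using Q by (intro ennreal_mult[symmetric]) auto
    also have "Q / Q ^ (m * j) * (Q ^ m / 2) ^ j = Q * (1 / 2) ^ j"
      using Q by (simp add: power_mult power_divide)
    finally show "ennreal (Q / Q ^ (m * j)) * (\<integral>\<^sup>+x. ennreal ((Q\<^sup>2) ^ exceed n f (\<mu> (real j)) x) \<partial>M)
        \<le> ennreal (Q * (1 / 2) ^ j)" .
  qed
  also have "(\<Sum>j=1..n. ennreal (Q * (1 / 2) ^ j)) = ennreal (Q * (\<Sum>j=1..n. (1 / 2) ^ j))"
    using Q by (subst sum_ennreal) (auto simp: sum_distrib_left)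
  also have "ennreal (Q ^ m) + ennreal (Q * (\<Sum>j=1..n. (1 / 2) ^ j)) \<le> ennreal (Q ^ m) + ennreal (Q * 1)"
    using geometric_sum_le[of "1 / 2" n] Q by (intro add_left_mono ennreal_leI mult_left_mono) auto
  also have "\<dots> = ennreal (Q ^ m + Q)" using Q by (simp add: ennreal_plus)
  finally show ?thesis by (simp only: Q_def)
qed

theorem upper_estimate:
  "(\<integral>\<^sup>+x. ennreal (\<Phi> (N (finite_seq n (\<lambda>k. f k x)))) \<partial>M)
    \<le> ennreal (D * (D * exp (D - 1) + (D\<^sup>2) ^ m + D\<^sup>2))
      * ((\<integral>\<^sup>+t. ennreal (\<Phi> (\<mu> t)) \<partial>unit_interval_measure) + ennreal (\<Phi> (N (finite_seq n \<beta>))))"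
proof -
  define Y where "Y x k = (if \<bar>f k x\<bar> > \<mu> 1 then f k x else 0)" for x k
  define W where "W x k = (if \<bar>f k x\<bar> \<le> \<mu> 1 then f k x else 0)" for x k
  define G where "G x = (\<Sum>k<n. D ^ exceed n f (\<mu> 1) x * (if \<bar>f k x\<bar> > \<mu> 1 then \<Phi> \<bar>f k x\<bar> else 0))" for x
  define H where "H x = (D\<^sup>2) ^ m
      + (\<Sum>j=1..n. D\<^sup>2 / (D\<^sup>2) ^ (m * j) * ((D\<^sup>2)\<^sup>2) ^ exceed n f (\<mu> (real j)) x)" for x
  define b where "b = \<Phi> (N (finite_seq n \<beta>))"
  define c1 where "c1 = D * exp (D - 1) + (D\<^sup>2) ^ m + D\<^sup>2"
  have c1: "c1 \<ge> 0" using D by (simp add: c1_def)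
  have b: "b \<ge> 0" by (simp add: b_def nonneg N_finite_seq_nonneg)
  have H0: "H x \<ge> 0" for x using D by (auto simp: H_def intro!: add_nonneg_nonneg sum_nonneg)
  have G0: "G x \<ge> 0" for x using D by (auto simp: G_def nonneg intro!: sum_nonneg)
  have "\<Phi> (N (finite_seq n (\<lambda>k. f k x))) \<le> D * (G x + H x * b)" for x
  proof -
    define t where "t = max (N (finite_seq n (Y x))) (N (finite_seq n (W x)))"
    have t: "t \<ge> 0" by (simp add: t_def le_max_iff_disj N_finite_seq_nonneg)
    have "finite_seq n (\<lambda>k. f k x) = (\<lambda>k. finite_seq n (Y x) k + finite_seq n (W x) k)"
      by (auto simp: finite_seq_def Y_def W_def)
    hence "N (finite_seq n (\<lambda>k. f k x)) \<le> K ^ 1 * t"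
      using N_add_le[OF finite_seq_mem finite_seq_mem, of n "Y x" n "W x"] by (simp add: t_def)
    hence "\<Phi> (N (finite_seq n (\<lambda>k. f k x))) \<le> \<Phi> (K ^ 1 * t)"
      by (intro mono N_finite_seq_nonneg)
    also have "\<dots> \<le> D ^ 1 * \<Phi> t" by (rule \<Phi>_dilation_le[OF t])
    also have "\<Phi> t \<le> \<Phi> (N (finite_seq n (Y x))) + \<Phi> (N (finite_seq n (W x)))"
      using nonneg[OF N_finite_seq_nonneg[of "Y x"]] nonneg[OF N_finite_seq_nonneg[of "W x"]]
      by (simp add: t_def max_def)
    also have "\<dots> \<le> G x + H x * b"
      using \<Phi>_large_le[of x] \<Phi>_small_le[of x] unfolding Y_def W_def G_def H_def b_def
      by (rule add_mono)
    finally show ?thesis using D by (simp add: mult_left_mono)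
  qed
  hence "(\<integral>\<^sup>+x. ennreal (\<Phi> (N (finite_seq n (\<lambda>k. f k x)))) \<partial>M)
      \<le> (\<integral>\<^sup>+x. ennreal D * (ennreal (G x) + ennreal (H x) * ennreal b) \<partial>M)"
    using D b H0 G0 by (intro nn_integral_mono)
      (simp add: ennreal_mult[symmetric] ennreal_plus[symmetric] del: ennreal_plus)
  also have "\<dots> = ennreal D * ((\<integral>\<^sup>+x. ennreal (G x) \<partial>M) + (\<integral>\<^sup>+x. ennreal (H x) \<partial>M) * ennreal b)"
  proof -
    have [measurable]: "exceed n f l \<in> measurable M (count_space UNIV)" for l
      by (rule exceed_measurable[where f = f and n = n, OF rv])
    have [measurable]: "H \<in> borel_measurable M" unfolding H_def by measurable
    have [measurable]: "G \<in> borel_measurable M"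
      unfolding G_def
    proof (rule borel_measurable_sum)
      fix k assume "k \<in> {..<n}"
      hence [measurable]: "random_variable borel (f k)" using rv by simp
      show "(\<lambda>x. D ^ exceed n f (\<mu> 1) x * (if \<bar>f k x\<bar> > \<mu> 1 then \<Phi> \<bar>f k x\<bar> else 0)) \<in> borel_measurable M"
        by measurable
    qed
    show ?thesis by (simp add: nn_integral_cmult nn_integral_add nn_integral_multc)
  qed
  also have "\<dots> \<le> ennreal D * (ennreal (D * exp (D - 1)) * (\<integral>\<^sup>+t. ennreal (\<Phi> (\<mu> t)) \<partial>unit_interval_measure)
      + ennreal ((D\<^sup>2) ^ m + D\<^sup>2) * ennreal b)"
  proof (intro mult_left_mono add_mono mult_right_mono)
    have "ennreal (G x) = (\<Sum>k<n. ennreal (D ^ exceed n f (\<mu> 1) x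
        * (if \<bar>f k x\<bar> > \<mu> 1 then \<Phi> \<bar>f k x\<bar> else 0)))" for x
      unfolding G_def using D by (intro sum_ennreal[symmetric]) (auto simp: nonneg)
    thus "(\<integral>\<^sup>+x. ennreal (G x) \<partial>M)
        \<le> ennreal (D * exp (D - 1)) * (\<integral>\<^sup>+t. ennreal (\<Phi> (\<mu> t)) \<partial>unit_interval_measure)"
      using nn_integral_large_le by simp
    show "(\<integral>\<^sup>+x. ennreal (H x) \<partial>M) \<le> ennreal ((D\<^sup>2) ^ m + D\<^sup>2)"
      unfolding H_def by (rule nn_integral_uniform_ratio_le)
  qed auto
  also have "\<dots> \<le> ennreal D * (ennreal c1 * (\<integral>\<^sup>+t. ennreal (\<Phi> (\<mu> t)) \<partial>unit_interval_measure)
      + ennreal c1 * ennreal b)"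
    using D by (intro mult_left_mono add_mono mult_right_mono ennreal_leI) (auto simp: c1_def)
  also have "\<dots> = ennreal (D * c1)
      * ((\<integral>\<^sup>+t. ennreal (\<Phi> (\<mu> t)) \<partial>unit_interval_measure) + ennreal b)"
    using D c1 by (simp add: ennreal_mult distrib_left mult.assoc)
  finally show ?thesis by (simp only: b_def c1_def)
qed

lemma nn_integral_\<mu>_le:
  "(\<integral>\<^sup>+t. ennreal (\<Phi> (\<mu> t)) \<partial>unit_interval_measure)
    \<le> 2 * (\<integral>\<^sup>+x. ennreal (\<Phi> (N (finite_seq n (\<lambda>k. f k x)))) \<partial>M)"
proof -
  have "(\<integral>\<^sup>+x. (SUP k\<in>{..<n}. ennreal (\<Phi> \<bar>f k x\<bar>)) \<partial>M)
      \<le> (\<integral>\<^sup>+x. ennreal (\<Phi> (N (finite_seq n (\<lambda>k. f k x)))) \<partial>M)"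
    by (intro nn_integral_mono SUP_least ennreal_leI mono abs_le_N) auto
  hence "2 * (\<integral>\<^sup>+x. (SUP k\<in>{..<n}. ennreal (\<Phi> \<bar>f k x\<bar>)) \<partial>M)
      \<le> 2 * (\<integral>\<^sup>+x. ennreal (\<Phi> (N (finite_seq n (\<lambda>k. f k x)))) \<partial>M)"
    by (rule mult_left_mono) simp
  with nn_integral_\<mu>_le_max[OF indep] show ?thesis by (rule order_trans)
qed

text \<open>A Chernoff bound with parameter \<open>\<theta> = 3\<close>: if the mean is at least \<open>j\<close>, then the count is below
  \<open>j / 40\<close> with probability at most \<open>exp (3 / 40 + exp (- 3) - 1) ^ j \<le> exp (- 4 / 5) ^ j\<close>. The
  constant \<open>40\<close> is large enough for these probabilities to add up to less than one.\<close>

lemma prob_exceed_less: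
  assumes "real j \<le> d l"
  shows "prob {x \<in> space M. 40 * exceed n f l x < j} \<le> (12 / 25) ^ j"
proof -
  define A where "A = {x \<in> space M. 40 * exceed n f l x < j}"
  have [measurable]: "exceed n f l \<in> measurable M (count_space UNIV)"
    by (rule exceed_measurable[where f = f and n = n, OF rv])
  have [measurable]: "A \<in> events" unfolding A_def by measurable
  define z :: real where "z = exp (- 3)"
  have z: "z \<ge> 0" "z - 1 \<le> - (7 / 8)"
  proof -
    have "(8::real) \<le> exp 3" using exp_lower_Taylor_quadratic[of "3::real"] by (simp add: power2_eq_square)
    hence "z \<le> 1 / 8" by (simp add: z_def exp_minus field_simps)
    thus "z - 1 \<le> - (7 / 8)" by simp
  qed (simp add: z_def)
  have "emeasure M A = (\<integral>\<^sup>+x. indicator A x \<partial>M)" by simp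
  also have "\<dots> \<le> (\<integral>\<^sup>+x. ennreal (exp (3 * real j / 40)) * ennreal (z ^ exceed n f l x) \<partial>M)"
  proof (rule nn_integral_mono)
    fix x
    show "indicator A x \<le> ennreal (exp (3 * real j / 40)) * ennreal (z ^ exceed n f l x)"
    proof (cases "x \<in> A")
      case True
      hence "3 * real (exceed n f l x) \<le> 3 * real j / 40" by (simp add: A_def)
      hence "1 \<le> exp (3 * real j / 40) * exp (- (3 * real (exceed n f l x)))"
        by (simp add: exp_add[symmetric])
      also have "exp (- (3 * real (exceed n f l x))) = z ^ exceed n f l x"
        by (simp add: z_def exp_of_nat_mult[symmetric] mult.commute)
      finally show ?thesis using True z(1) by (simp add: ennreal_mult[symmetric])
    qed simp
  qed
  also have "\<dots> = ennreal (exp (3 * real j / 40)) * (\<integral>\<^sup>+x. ennreal (z ^ exceed n f l x) \<partial>M)"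
    by (rule nn_integral_cmult) measurable
  also have "\<dots> \<le> ennreal (exp (3 * real j / 40)) * ennreal (exp ((z - 1) * d l))"
    by (intro mult_left_mono nn_integral_power_exceed indep z) simp
  also have "\<dots> = ennreal (exp (3 * real j / 40 + (z - 1) * d l))"
    by (simp add: ennreal_mult[symmetric] exp_add)
  also have "\<dots> \<le> ennreal (exp (- (4 / 5)) ^ j)"
  proof (rule ennreal_leI)
    have "(z - 1) * d l \<le> (z - 1) * real j" using z assms by (intro mult_left_mono_neg) auto
    also have "\<dots> \<le> - (7 / 8) * real j" using z by (intro mult_right_mono) auto
    finally have "3 * real j / 40 + (z - 1) * d l \<le> real j * (- (4 / 5))" by simp
    hence "exp (3 * real j / 40 + (z - 1) * d l) \<le> exp (real j * (- (4 / 5)))"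
      by (simp only: exp_le_cancel_iff)
    thus "exp (3 * real j / 40 + (z - 1) * d l) \<le> exp (- (4 / 5)) ^ j"
      by (simp only: exp_of_nat_mult)
  qed
  also have "\<dots> \<le> ennreal ((12 / 25) ^ j)"
  proof (intro ennreal_leI power_mono)
    have "(25 / 12 :: real) \<le> exp (4 / 5)"
      using exp_lower_Taylor_quadratic[of "4 / 5 :: real"] by (simp add: power2_eq_square)
    thus "exp (- (4 / 5)) \<le> (12 / 25 :: real)" by (simp add: exp_minus field_simps)
  qed simp
  finally show ?thesis by (simp add: emeasure_eq_measure A_def)
qed

text \<open>By \<open>prob_exceed_less\<close> and \<open>\<Sum>j\<ge>1. (12 / 25) ^ j = 12 / 13\<close>, the event \<open>G\<close> on which at least
  \<open>j / 40\<close> of the \<open>\<bar>f k x\<bar>\<close> exceed \<open>\<mu> j / 2\<close>, for all \<open>j\<close> with \<open>\<mu> j > 0\<close>, has probability at least \<open>1 / 13\<close>. On \<open>G\<close> a dilation by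
  \<open>40\<close> compares \<open>\<beta> / 2\<close> with the sequence of the \<open>f k x\<close>; undoing the factor \<open>1 / 2\<close> costs one more
  power of \<open>K \<ge> 2\<close>. Levels with \<open>\<mu> j = 0\<close> are left out of \<open>G\<close>: there \<open>d\<close> may be smaller than
  \<open>j\<close>, and they contribute nothing to \<open>\<beta>\<close>.\<close>

lemma \<Phi>_\<beta>_le:
  "ennreal (\<Phi> (N (finite_seq n \<beta>)))
    \<le> ennreal (13 * D ^ 41) * (\<integral>\<^sup>+x. ennreal (\<Phi> (N (finite_seq n (\<lambda>k. f k x)))) \<partial>M)"
proof -
  define J where "J = {j \<in> {1..n}. \<mu> (real j) > 0}"
  define B where "B j = {x \<in> space M. 40 * exceed n f (\<mu> (real j) / 2) x < j}" for j
  define G where "G = space M - (\<Union>j\<in>J. B j)"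
  define b where "b = \<Phi> (N (finite_seq n \<beta>)) / D ^ 41"
  have [measurable]: "exceed n f l \<in> measurable M (count_space UNIV)" for l
    by (rule exceed_measurable[where f = f and n = n, OF rv])
  have B[measurable]: "B j \<in> events" for j unfolding B_def by measurable
  have J: "finite J" by (simp add: J_def)
  have UB: "(\<Union>j\<in>J. B j) \<in> events" using J by auto
  have "prob (\<Union>j\<in>J. B j) \<le> (\<Sum>j\<in>J. prob (B j))"
    using J by (intro finite_measure_subadditive_finite) auto
  also have "\<dots> \<le> (\<Sum>j\<in>J. (12 / 25) ^ j)"
    unfolding B_def by (intro sum_mono prob_exceed_less le_d) (auto simp: J_def)
  also have "\<dots> \<le> (\<Sum>j=1..n. (12 / 25) ^ j)" by (intro sum_mono2) (auto simp: J_def)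
  also have "\<dots> \<le> 12 / 13" using geometric_sum_le[of "12 / 25" n] by simp
  finally have G: "prob G \<ge> 1 / 13" unfolding G_def using prob_compl[OF UB] by simp
  have b: "b \<ge> 0" using D by (simp add: b_def nonneg N_finite_seq_nonneg)
  have bound: "b \<le> \<Phi> (N (finite_seq n (\<lambda>k. f k x)))" if x: "x \<in> G" for x
  proof -
    have "level_count (finite_seq n (\<lambda>k. \<beta> k / 2)) l
        \<le> 40 * level_count (finite_seq n (\<lambda>k. f k x)) l" if "l \<ge> 0" for l
      using x that by (intro level_count_half_\<beta>_le) (auto simp: G_def B_def J_def not_less)
    hence le: "N (finite_seq n (\<lambda>k. \<beta> k / 2)) \<le> K ^ 40 * N (finite_seq n (\<lambda>k. f k x))"
      by (intro N_dilation_le finite_seq_support)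
    have "finite_seq n \<beta> = (\<lambda>k. 2 * finite_seq n (\<lambda>k. \<beta> k / 2) k)"
      by (auto simp: finite_seq_def)
    hence "N (finite_seq n \<beta>) = 2 * N (finite_seq n (\<lambda>k. \<beta> k / 2))"
      using N_scale[OF finite_seq_mem, of 2 n "\<lambda>k. \<beta> k / 2"] by simp
    also have "\<dots> \<le> K * (K ^ 40 * N (finite_seq n (\<lambda>k. f k x)))"
      using K le by (intro mult_mono N_finite_seq_nonneg) auto
    also have "\<dots> = K ^ 41 * N (finite_seq n (\<lambda>k. f k x))"
      by (simp only: mult.assoc[symmetric] power_Suc[symmetric]) simp
    finally have "\<Phi> (N (finite_seq n \<beta>)) \<le> \<Phi> (K ^ 41 * N (finite_seq n (\<lambda>k. f k x)))"
      by (intro mono N_finite_seq_nonneg)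
    also have "\<dots> \<le> D ^ 41 * \<Phi> (N (finite_seq n (\<lambda>k. f k x)))"
      by (intro \<Phi>_dilation_le N_finite_seq_nonneg)
    finally show ?thesis using D by (simp add: b_def field_simps)
  qed
  have "ennreal b * ennreal (1 / 13) \<le> ennreal b * emeasure M G"
    using G by (intro mult_left_mono) (auto simp: emeasure_eq_measure)
  also have "\<dots> = (\<integral>\<^sup>+x. ennreal b * indicator G x \<partial>M)"
    using UB by (simp add: nn_integral_cmult_indicator G_def)
  also have "\<dots> \<le> (\<integral>\<^sup>+x. ennreal (\<Phi> (N (finite_seq n (\<lambda>k. f k x)))) \<partial>M)"
    using bound by (intro nn_integral_mono) (auto simp: indicator_def intro: ennreal_leI)
  finally have "ennreal (13 * D ^ 41) * (ennreal b * ennreal (1 / 13))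
      \<le> ennreal (13 * D ^ 41) * (\<integral>\<^sup>+x. ennreal (\<Phi> (N (finite_seq n (\<lambda>k. f k x)))) \<partial>M)"
    by (rule mult_left_mono) simp
  moreover have "ennreal (13 * D ^ 41) * (ennreal b * ennreal (1 / 13)) = ennreal (13 * D ^ 41 * (b * (1 / 13)))"
  proof -
    have "ennreal b * ennreal (1 / 13) = ennreal (b * (1 / 13))"
      using b by (subst ennreal_mult[of b "1 / 13"]) auto
    thus ?thesis
      using D b by (subst ennreal_mult[of "13 * D ^ 41" "b * (1 / 13)"]) auto
  qed
  moreover have "13 * D ^ 41 * (b * (1 / 13)) = \<Phi> (N (finite_seq n \<beta>))"
    using D by (simp add: b_def)
  ultimately show ?thesis by simp
qed

theorem lower_estimate:
  "ennreal (1 / (2 + 13 * D ^ 41))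
      * ((\<integral>\<^sup>+t. ennreal (\<Phi> (\<mu> t)) \<partial>unit_interval_measure) + ennreal (\<Phi> (N (finite_seq n \<beta>))))
    \<le> (\<integral>\<^sup>+x. ennreal (\<Phi> (N (finite_seq n (\<lambda>k. f k x)))) \<partial>M)" (is "_ * ?rhs \<le> ?lhs")
proof -
  define c where "c = 2 + 13 * D ^ 41"
  have "D ^ 41 \<ge> 0" using D by simp
  hence c: "c > 0" unfolding c_def by linarith
  have "?rhs \<le> 2 * ?lhs + ennreal (13 * D ^ 41) * ?lhs"
    by (intro add_mono nn_integral_\<mu>_le \<Phi>_\<beta>_le)
  also have "\<dots> = ennreal c * ?lhs"
    unfolding c_def using \<open>D ^ 41 \<ge> 0\<close> by (subst ennreal_plus) (auto simp: distrib_right)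
  finally have "ennreal (1 / c) * ?rhs \<le> ennreal (1 / c) * (ennreal c * ?lhs)"
    by (rule mult_left_mono) simp
  also have "\<dots> = ?lhs" using c by (simp add: mult.assoc[symmetric] ennreal_mult[symmetric])
  finally show ?thesis by (simp add: c_def)
qed

end

theorem theorem1p3:
  fixes \<Phi> :: "real \<Rightarrow> real"
    and E :: "(nat \<Rightarrow> real) set" and N :: "(nat \<Rightarrow> real) \<Rightarrow> real"
  assumes "orlicz_function \<Phi>" and "Delta2 \<Phi>"
    and "symmetric_quasi_banach_sequence_space E N"
  shows "\<exists>c C :: real. 0 < c \<and> 0 < C \<and>
    (\<forall>(n :: nat) (f :: nat \<Rightarrow> real \<Rightarrow> real).
       (\<forall>k<n. f k \<in> orlicz_space \<Phi>) \<longrightarrow>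
       prob_space.indep_vars unit_interval_measure (\<lambda>_. borel) f {..<n} \<longrightarrow>
       (let F = disjoint_sum n f;
            lhs = (\<integral>\<^sup>+t. ennreal (\<Phi> (N (finite_seq n (\<lambda>k. f k t)))) \<partial>unit_interval_measure);
            rhs = (\<integral>\<^sup>+t. ennreal (\<Phi> (rearrangement half_line_measure F t)) \<partial>unit_interval_measure)
                + ennreal (\<Phi> (N (finite_seq n (\<lambda>k. rearrangement half_line_measure F (real (Suc k))))))
        in ennreal c * rhs \<le> lhs \<and> lhs \<le> ennreal C * rhs))"
proof -
  interpret orlicz_function \<Phi> by fact
  interpret symmetric_quasi_banach_sequence_space E N by fact
  obtain K where K: "K \<ge> 2"
    "\<And>a b. a \<in> E \<Longrightarrow> b \<in> E \<Longrightarrow> N (\<lambda>k. a k + b k) \<le> K * max (N a) (N b)"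
    "\<And>y b j. finite {k. y k \<noteq> 0} \<Longrightarrow> finite {k. b k \<noteq> 0} \<Longrightarrow>
      (\<And>l. l \<ge> 0 \<Longrightarrow> level_count y l \<le> j * level_count b l) \<Longrightarrow> N y \<le> K ^ j * N b"
    by (rule N_dilation_bound) blast
  have "K \<ge> 1" using K by simp
  then obtain D where D: "D \<ge> 2" "\<And>t j. t \<ge> 0 \<Longrightarrow> \<Phi> (K ^ j * t) \<le> D ^ j * \<Phi> t"
    by (rule dilation_power_bound[OF assms(2)]) blast
  have "D\<^sup>2 > 1" using D(1) by (simp add: one_less_power)
  then obtain i where i: "2 * exp (((D\<^sup>2)\<^sup>2) - 1) < (D\<^sup>2) ^ i"
    using real_arch_pow by blast
  define m where "m = Suc i"
  have "(D\<^sup>2) ^ i \<le> (D\<^sup>2) ^ m" using \<open>D\<^sup>2 > 1\<close> by (intro power_increasing) (auto simp: m_def)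
  with i have m: "m \<ge> 1" "2 * exp (((D\<^sup>2)\<^sup>2) - 1) \<le> (D\<^sup>2) ^ m" by (auto simp: m_def)
  define c where "c = 1 / (2 + 13 * D ^ 41)"
  define C where "C = D * (D * exp (D - 1) + (D\<^sup>2) ^ m + D\<^sup>2)"
  have "c > 0" "C > 0" using D(1) by (auto simp: c_def C_def intro!: add_pos_pos mult_pos_pos divide_pos_pos)
  moreover have "ennreal c * ((\<integral>\<^sup>+t. ennreal (\<Phi> (rearrangement half_line_measure F t)) \<partial>unit_interval_measure)
        + ennreal (\<Phi> (N (finite_seq n (\<lambda>k. rearrangement half_line_measure F (real (Suc k)))))))
      \<le> (\<integral>\<^sup>+t. ennreal (\<Phi> (N (finite_seq n (\<lambda>k. f k t)))) \<partial>unit_interval_measure)"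
    (is "_ * ?rhs \<le> ?lhs")
    "(\<integral>\<^sup>+t. ennreal (\<Phi> (N (finite_seq n (\<lambda>k. f k t)))) \<partial>unit_interval_measure)
      \<le> ennreal C * ((\<integral>\<^sup>+t. ennreal (\<Phi> (rearrangement half_line_measure F t)) \<partial>unit_interval_measure)
        + ennreal (\<Phi> (N (finite_seq n (\<lambda>k. rearrangement half_line_measure F (real (Suc k)))))))"
    if f: "\<forall>k<n. f k \<in> orlicz_space \<Phi>"
      and indep: "prob_space.indep_vars unit_interval_measure (\<lambda>_. borel) f {..<n}"
      and F: "F = disjoint_sum n f"
    for n f F
  proof -
    interpret R: rearranged_tail unit_interval_measure n f "rearrangement half_line_measure F"
      unfolding F by (rule rearrangement_disjoint_sum) (use f in \<open>auto simp: orlicz_space_def\<close>)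
    interpret S: independent_tail_in_sequence_space unit_interval_measure n f
      "rearrangement half_line_measure F" \<Phi> E N K D m
      by unfold_locales (use assms(2) indep K D m in auto)
    have \<beta>: "R.\<beta> = (\<lambda>k. rearrangement half_line_measure F (real (Suc k)))"
      by (simp add: R.\<beta>_def fun_eq_iff)
    show "ennreal c * ?rhs \<le> ?lhs" using S.lower_estimate by (simp only: c_def \<beta>)
    show "?lhs \<le> ennreal C * ?rhs" using S.upper_estimate by (simp only: C_def \<beta>)
  qed
  ultimately show ?thesis unfolding Let_def by blast
qed

end
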